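(* Let $T$ be a partially bounded rank-one transformation with parameters $(r_n)$ and $(s_n)$, where $s_n=(s_n(0),\dots,s_n(r_n-2))$. Then $T$ is isomorphic to $T^{-1}$ if and only if there exists $N\in\mathbb{N}$ such that for all $n\ge N$, $s_n=\overline{s_n}$, where $\overline{s_n}$ is the reverse of $s_n$, i.e. $\overline{s_n}(i)=s_n(r_n-2-i)$ for $0\le i\le r_n-2$.
   Context: All statements about maps and sets are understood up to null sets (a.e.). Rank-one transformations with no spacers on the final subcolumn (cutting and stacking). Let $(r_n)_{n\ge 0}$ be integers $r_n\ge 2$ (cutting parameters) and, for each $n$, let $s_n=(s_n(0),\dots,s_n(r_n-2))$ be an $(r_n-1)$-tuple of non-negative integers (spacer parameters; by convention the number of spacers on the last subcolumn is $0$ and is omitted from the tuple). A column of height $h$ is a finite ordered sequence of $h$ disjoint left-closed right-open intervals (levels) of equal length; it defines a partial map sending each level except the top one to the next level by translation. Start with the column $C_0=\{B_0\}$, $B_0=[0,1)$, of height $h_0=1$. Given $C_n=\{B_n,T(B_n),\dots,T^{h_n-1}(B_n)\}$, cut each level into $r_n$ subintervals of equal length (ordered left to right), giving subcolumns $0,\dots,r_n-1$; place $s_n(i)$ new disjoint intervals (spacers) of the same length on top of the $i$-th subcolumn for $0\le i\le r_n-2$, and none on the last; stack subcolumn $i+1$ on top of subcolumn $i$ for each $i$, to obtain $C_{n+1}$, whose base $B_{n+1}$ is the leftmost subinterval of $B_n$. The space $X$ is the union of all levels of all columns, with Lebesgue measure $\mu$, and $T$ is the a.e.-defined limit of the partial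 maps; it is an invertible measure-preserving ergodic transformation, called the rank-one transformation with parameters $(r_n),(s_n)$. Rank-one words: $w_0=0$ and $w_{n+1}=w_n1^{s_n(0)}w_n1^{s_n(1)}\cdots 1^{s_n(r_n-2)}w_n$ (with $r_n$ copies of $w_n$); $|w_n|$ is the length of $w_n$. Partially bounded with parameters $(r_n),(s_n)$: there are integers $\mathfrak{R}>0$, $\mathfrak{S}>0$ and $N_0$ such that for all $n\ge N_0$: (1) $r_n<\mathfrak{R}$; (2) $|s_n(i)-s_n(j)|<\mathfrak{S}$ for $0\le i,j<r_n-1$; (3) $s_n(i)\ge |w_n|$ for $0\le i<r_n-1$. Two measure-preserving transformations $T$ of $(X,\mu)$ and $T'$ of $(Y,\nu)$ are isomorphic if there is an a.e.-invertible measure-preserving map $\phi:X\to Y$ with $\phi\circ T=T'\circ\phi$ a.e. *)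

theory Defs
  imports "HOL-Analysis.Analysis"
begin

text \<open>
  Cutting parameters are \<open>r :: nat \<Rightarrow> nat\<close>; the spacer tuple \<open>s n\<close> is a list of length \<open>r n - 1\<close>.
\<close>

definition rank_one_parameters :: "(nat \<Rightarrow> nat) \<Rightarrow> (nat \<Rightarrow> nat list) \<Rightarrow> bool" where
  "rank_one_parameters r s \<longleftrightarrow> (\<forall>n. r n \<ge> 2 \<and> length (s n) = r n - 1)"

text \<open>
  A column is given by the list of the left endpoints of its levels, from the base upwards,
  together with the common length \<open>w\<close> of the levels.
\<close>

definition level :: "real \<Rightarrow> real list \<Rightarrow> nat \<Rightarrow> real set" where
  "level w c i = {c ! i ..< c ! i + w}"

definition is_column :: "real \<Rightarrow> real list \<Rightarrow> bool" where
  "is_column w c \<longleftrightarrow> 0 < w \<and> disjoint_family_on (level w c) {..<length c}"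

definition level_width :: "(nat \<Rightarrow> nat) \<Rightarrow> nat \<Rightarrow> real" where
  "level_width r n = 1 / (\<Prod>k<n. real (r k))"

text \<open>
  \<open>cut_and_stack m w c sps\<close> cuts each level of \<open>c\<close> into \<open>m\<close> pieces of length \<open>w\<close>, puts the spacers
  with left endpoints \<open>sps ! i\<close> on top of subcolumn \<open>i\<close> for \<open>i < m - 1\<close> and none on the last one,
  and stacks the subcolumns from left to right.
\<close>

definition cut_and_stack :: "nat \<Rightarrow> real \<Rightarrow> real list \<Rightarrow> real list list \<Rightarrow> real list" where
  "cut_and_stack m w c sps =
     concat (map (\<lambda>i. map (\<lambda>a. a + real i * w) c @ (if i < m - 1 then sps ! i else [])) [0..<m])"

text \<open>
  \<open>C\<close> is a sequence of columns produced by the construction. The position of the spacers is not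
  prescribed: they only have to be new, that is, disjoint from each other and from the levels of
  \<open>C n\<close> (which cover all earlier levels). This is what \<open>is_column\<close> for \<open>C (Suc n)\<close> expresses.
\<close>

definition rank_one_columns ::
    "(nat \<Rightarrow> nat) \<Rightarrow> (nat \<Rightarrow> nat list) \<Rightarrow> (nat \<Rightarrow> real list) \<Rightarrow> bool" where
  "rank_one_columns r s C \<longleftrightarrow>
     C 0 = [0] \<and>
     (\<forall>n. is_column (level_width r n) (C n) \<and>
          (\<exists>sps. map length sps = s n \<and>
                 C (Suc n) = cut_and_stack (r n) (level_width r (Suc n)) (C n) sps))"

definition rank_one_space :: "(nat \<Rightarrow> nat) \<Rightarrow> (nat \<Rightarrow> real list) \<Rightarrow> real set" where
  "rank_one_space r C = (\<Union>n. \<Union>i<length (C n). level (level_width r n) (C n) i)"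

text \<open>
  The common extension of the partial maps translating each level but the top one of \<open>C n\<close> to the
  next. For a sequence \<open>C\<close> as above, the partial maps are compatible, so that the value is unique
  at every point of a level that is not a top level. As the top levels of the \<open>C n\<close> are nested
  with common right endpoint and are right-open, this covers all of the space, and the map is
  injective there. Its range is the space without the single point \<open>0\<close>, the intersection of the
  bases; hence \<open>inv_into\<close> on the space is its a.e. inverse.
\<close>

definition rank_one_map :: "(nat \<Rightarrow> nat) \<Rightarrow> (nat \<Rightarrow> real list) \<Rightarrow> real \<Rightarrow> real" where
  "rank_one_map r C x =
     (THE y. \<exists>n i. Suc i < length (C n) \<and> x \<in> level (level_width r n) (C n) i \<and>
                   y = C n ! Suc i + (x - C n ! i))"

fun rank_one_word :: "(nat \<Rightarrow> nat list) \<Rightarrow> nat \<Rightarrow> nat list" where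
  "rank_one_word s 0 = [0]"
| "rank_one_word s (Suc n) =
     concat (map (\<lambda>k. rank_one_word s n @ replicate k 1) (s n)) @ rank_one_word s n"

definition partially_bounded :: "(nat \<Rightarrow> nat) \<Rightarrow> (nat \<Rightarrow> nat list) \<Rightarrow> bool" where
  "partially_bounded r s \<longleftrightarrow>
     (\<exists>R S N\<^sub>0. 0 < R \<and> 0 < S \<and>
        (\<forall>n\<ge>N\<^sub>0. r n < R \<and>
           (\<forall>i<r n - 1. \<forall>j<r n - 1. \<bar>int (s n ! i) - int (s n ! j)\<bar> < S) \<and>
           (\<forall>i<r n - 1. length (rank_one_word s n) \<le> s n ! i)))"

definition measure_preserving_map :: "'a measure \<Rightarrow> 'b measure \<Rightarrow> ('a \<Rightarrow> 'b) \<Rightarrow> bool" where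
  "measure_preserving_map M N f \<longleftrightarrow>
     f \<in> M \<rightarrow>\<^sub>M N \<and> (\<forall>A\<in>sets N. emeasure M (f -` A \<inter> space M) = emeasure N A)"

text \<open>
  Transformations are only considered up to null sets, so nothing is required of \<open>T\<close> and \<open>T'\<close>
  off a set of full measure.
\<close>

definition isomorphic_transformations ::
    "'a measure \<Rightarrow> ('a \<Rightarrow> 'a) \<Rightarrow> 'b measure \<Rightarrow> ('b \<Rightarrow> 'b) \<Rightarrow> bool" where
  "isomorphic_transformations M T N T' \<longleftrightarrow>
     (\<exists>\<phi> \<psi>. measure_preserving_map M N \<phi> \<and> \<psi> \<in> N \<rightarrow>\<^sub>M M \<and>
            (AE x in M. \<psi> (\<phi> x) = x) \<and> (AE y in N. \<phi> (\<psi> y) = y) \<and>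
            (AE x in M. \<phi> (T x) = T' (\<phi> x)))"

end

theory Submission
  imports Defs
begin

text \<open>
  Suppose first that \<open>s n\<close> is a palindrome for all \<open>n \<ge> N\<close>. Turning the column \<open>C n\<close> upside down and
  reflecting each of its levels reverses the dynamics inside \<open>C n\<close>. Cutting a reflected interval
  reverses the order of the subcolumns, and the spacers over them are placed symmetrically, so the
  flips of \<open>C n\<close> for different \<open>n \<ge> N\<close> agree. Their common extension is a measure-preserving
  involution, off the countable set of left endpoints, that conjugates \<open>T\<close> to its inverse.

  Conversely, let \<open>\<phi>\<close> preserve the measure with \<open>\<phi> \<circ> T = T\<inverse> \<circ> \<phi>\<close>. Fix a stage \<open>M\<close> after which
  all spacers are long and the number of cuts is bounded by \<open>R\<close>, and let \<open>E\<close> be the preimage of the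
  base of \<open>C M\<close> under \<open>\<phi>\<close>. For large \<open>n\<close> the set \<open>E\<close> is almost a union of levels of \<open>C n\<close>, with a set
  \<open>I\<close> of indices. By averaging (\<open>few_visits\<close>) there is a typical point \<open>x\<close> in the base of \<open>C (Suc n)\<close>
  whose passages through all \<open>r n\<close> copies of \<open>C n\<close> inside \<open>C (Suc n)\<close> visit \<open>E\<close> at almost the same
  times \<open>I\<close>. On the other hand these visits are the visits of the backward orbit of \<open>\<phi> x\<close> to the
  base of \<open>C M\<close>, and these form reversed copies of one pattern: the heights at which the base
  of \<open>C M\<close> occurs in \<open>C n\<close>. Copies of \<open>C n\<close> have length \<open>h n\<close> and are separated by at least \<open>h n\<close>, so a single passage of \<open>x\<close> sees at most one
  reversed copy. The pattern overlaps each proper translate of itself in a proportion of at most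
  \<open>1 - 1/R\<close> (\<open>few_self_overlaps\<close>), and hence the reversed copy sits at the same offset in every
  passage. So the \<open>r n\<close> copies met by \<open>x\<close> are matched, up to one translation, with \<open>r n\<close> copies
  met backwards by \<open>\<phi> x\<close>. The latter cannot be spread over two copies of \<open>C (Suc n)\<close>, because the
  gap between those is too long. They are therefore all the copies in one \<open>C (Suc n)\<close> in reverse
  order, and comparing the gaps gives \<open>s n = rev (s n)\<close>.
\<close>

section \<open>Concatenations and isometries of the line\<close>

lemma concat_nth_offset:
  assumes "i < length xs" "k < length (xs ! i)"
  shows "concat xs ! ((\<Sum>j<i. length (xs ! j)) + k) = xs ! i ! k"
  using assms
proof (induction xs arbitrary: i)
  case (Cons x xs)
  show ?case
  proof (cases i)
    case 0
    then show ?thesis using Cons by (simp add: nth_append)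
  next
    case (Suc i')
    have "(\<Sum>j<Suc i'. length ((x # xs) ! j)) = length x + (\<Sum>j<i'. length (xs ! j))"
      by (subst sum.lessThan_Suc_shift) simp
    then show ?thesis using Cons Suc by (simp add: nth_append add.assoc)
  qed
qed simp

lemma length_concat_sum: "length (concat xs) = (\<Sum>j<length xs. length (xs ! j))"
  by (simp add: length_concat sum_list_sum_nth atLeast0LessThan)

lemma
  fixes t c :: real
  assumes c: "\<bar>c\<bar> = 1" and S: "S \<in> sets lebesgue"
  shows sets_isometry_vimage: "(\<lambda>x. t + c * x) -` S \<in> sets lebesgue" (is ?s)
    and emeasure_isometry_vimage: "emeasure lebesgue ((\<lambda>x. t + c * x) -` S) = emeasure lebesgue S" (is ?e)
proof -
  have "(\<lambda>x. t + c * x) \<in> lebesgue \<rightarrow>\<^sub>M lebesgue"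
    using lebesgue_affine_measurable[of "\<lambda>_. c" t] c by (auto simp: Basis_real_def)
  from measurable_sets[OF this S] show ?s by simp
  have cc: "c * c = 1" using c by (metis abs_mult_self_eq mult_1)
  have "(\<lambda>x. t + c * x) -` S = (\<lambda>x. c *\<^sub>R x + - c * t) ` S"
  proof (intro equalityI subsetI)
    fix x assume "x \<in> (\<lambda>x. t + c * x) -` S"
    moreover have "x = c *\<^sub>R (t + c * x) + - c * t"
      using cc by (simp add: algebra_simps flip: mult.assoc)
    ultimately show "x \<in> (\<lambda>x. c *\<^sub>R x + - c * t) ` S" by blast
  next
    fix x assume "x \<in> (\<lambda>x. c *\<^sub>R x + - c * t) ` S"
    then obtain y where y: "y \<in> S" "x = c * y - c * t" by auto
    have "t + c * x = t + (c * c) * y - (c * c) * t" by (simp add: y algebra_simps)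
    then show "x \<in> (\<lambda>x. t + c * x) -` S" using y by (simp add: cc)
  qed
  then show ?e
    using emeasure_lebesgue_affine[of c "- c * t" S] c by simp
qed

lemma AE_lebesgue_translate:
  assumes "AE x in lebesgue. P (x::real)" shows "AE x in lebesgue. P (x + c)"
proof -
  obtain N where N: "{x. \<not> P x} \<subseteq> N" "emeasure lebesgue N = 0" "N \<in> sets lebesgue"
    using assms by (auto elim!: AE_E)
  have "(\<lambda>x. c + 1 * x) -` N \<in> sets lebesgue" "emeasure lebesgue ((\<lambda>x. c + 1 * x) -` N) = 0"
    using sets_isometry_vimage[of 1 N c] emeasure_isometry_vimage[of 1 N c] N by auto
  then show ?thesis
    using N(1) by (intro AE_I[of _ _ "(\<lambda>x. c + 1 * x) -` N"]) (auto simp: add.commute)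
qed

section \<open>Levels of the columns\<close>

locale rank_one_system =
  fixes r :: "nat \<Rightarrow> nat" and s :: "nat \<Rightarrow> nat list" and C :: "nat \<Rightarrow> real list"
  assumes parameters: "rank_one_parameters r s"
    and columns: "rank_one_columns r s C"
begin

abbreviation h :: "nat \<Rightarrow> nat" where "h n \<equiv> length (C n)"

abbreviation w :: "nat \<Rightarrow> real" where "w n \<equiv> level_width r n"

abbreviation L :: "nat \<Rightarrow> nat \<Rightarrow> real set" where "L n i \<equiv> level (w n) (C n) i"

abbreviation X :: "real set" where "X \<equiv> rank_one_space r C"

abbreviation T :: "real \<Rightarrow> real" where "T \<equiv> rank_one_map r C"

text \<open>The height in \<open>C (Suc n)\<close> at which the copy of \<open>C n\<close> from subcolumn \<open>i\<close> begins.\<close>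

definition start :: "nat \<Rightarrow> nat \<Rightarrow> nat" where
  "start n i = i * h n + (\<Sum>j<i. s n ! j)"

lemma r_ge_2: "r n \<ge> 2" and length_s: "length (s n) = r n - 1"
  using parameters by (auto simp: rank_one_parameters_def)

lemma r_pos: "r n > 0"
  using r_ge_2[of n] by linarith

lemma w_pos: "w n > 0"
  unfolding level_width_def using r_pos by (auto intro!: divide_pos_pos prod_pos)

lemma w_Suc: "w n = real (r n) * w (Suc n)"
  using r_pos[of n] by (simp add: level_width_def)

lemma w_tendsto_0: "w \<longlonglongrightarrow> 0"
proof (rule Lim_null_comparison)
  have "w n \<le> (1/2) ^ n" for n
  proof (induction n)
    case (Suc n)
    have "2 * w (Suc n) \<le> w n"
      unfolding w_Suc[of n] using r_ge_2[of n] w_pos[of "Suc n"] by (intro mult_right_mono) auto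
    then show ?case using Suc by simp
  qed (simp add: level_width_def)
  then show "\<forall>\<^sub>F n in sequentially. norm (w n) \<le> (1/2) ^ n"
    using w_pos by (auto simp: less_imp_le)
qed (simp add: LIMSEQ_power_zero)

lemma mem_L: "x \<in> L n i \<longleftrightarrow> C n ! i \<le> x \<and> x < C n ! i + w n"
  by (auto simp: level_def)

lemma start_0 [simp]: "start n 0 = 0"
  by (simp add: start_def)

lemma start_Suc: "start n (Suc i) = start n i + h n + s n ! i"
  by (simp add: start_def)

lemma start_less: "i < j \<Longrightarrow> start n i + h n + s n ! i \<le> start n j"
proof (induction j)
  case (Suc j)
  then show ?case by (cases "i = j") (auto simp: start_Suc)
qed simp

lemma start_strict_mono: "h n > 0 \<Longrightarrow> i < j \<Longrightarrow> start n i < start n j"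
  using start_less[of i j n] by linarith

lemma C_Suc:
  obtains sps where "map length sps = s n" "C (Suc n) = cut_and_stack (r n) (w (Suc n)) (C n) sps"
  using columns unfolding rank_one_columns_def by blast

lemma nth_C_Suc:
  assumes "i < r n" "k < h n"
  shows "C (Suc n) ! (start n i + k) = C n ! k + real i * w (Suc n)"
proof -
  obtain sps where sps: "map length sps = s n"
    "C (Suc n) = cut_and_stack (r n) (w (Suc n)) (C n) sps" by (rule C_Suc)
  define f where "f = (\<lambda>i. map (\<lambda>a. a + real i * w (Suc n)) (C n) @ (if i < r n - 1 then sps ! i else []))"
  have len: "length (f j) = h n + s n ! j" if "j < r n - 1" for j
    using that arg_cong[OF sps(1), of length] length_s[of n] by (simp add: f_def flip: sps(1))
  have "start n i = (\<Sum>j<i. length (map f [0..<r n] ! j))"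
    using assms by (simp add: start_def len sum.distrib)
  moreover have "k < length (map f [0..<r n] ! i)"
    using assms by (simp add: f_def)
  ultimately have "concat (map f [0..<r n]) ! (start n i + k) = f i ! k"
    using assms concat_nth_offset[of i "map f [0..<r n]" k] by simp
  then show ?thesis
    using assms sps(2) by (simp add: cut_and_stack_def f_def nth_append)
qed

lemma h_Suc: "h (Suc n) = start n (r n - 1) + h n"
proof -
  obtain sps where sps: "map length sps = s n"
    "C (Suc n) = cut_and_stack (r n) (w (Suc n)) (C n) sps" by (rule C_Suc)
  define f where "f = (\<lambda>i. map (\<lambda>a. a + real i * w (Suc n)) (C n) @ (if i < r n - 1 then sps ! i else []))"
  have len: "length (f j) = h n + s n ! j" if "j < r n - 1" for j
    using that arg_cong[OF sps(1), of length] length_s[of n] by (simp add: f_def flip: sps(1))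
  have "C (Suc n) = concat (map f [0..<r n])"
    by (simp only: sps(2) cut_and_stack_def f_def)
  then have "h (Suc n) = (\<Sum>j<r n. length (f j))"
    by (simp add: length_concat_sum)
  also have "\<dots> = (\<Sum>j<r n - 1. length (f j)) + length (f (r n - 1))"
    using r_pos[of n] by (metis Suc_diff_1 sum.lessThan_Suc)
  also have "\<dots> = start n (r n - 1) + h n"
    by (simp add: start_def len sum.distrib) (simp add: f_def)
  finally show ?thesis .
qed

lemma h_pos: "h n > 0"
proof (induction n)
  case 0
  then show ?case using columns by (simp add: rank_one_columns_def)
qed (simp add: h_Suc)

lemma start_add_less:
  assumes "i < r n" "k < h n" shows "start n i + k < h (Suc n)"
proof (cases "i = r n - 1")
  case False
  then have "start n i + h n \<le> start n (r n - 1)" using assms start_less[of i "r n - 1" n] by linarith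
  then show ?thesis using assms h_Suc[of n] by linarith
qed (use assms h_Suc in simp)

lemma start_add_le: "i < r n \<Longrightarrow> start n i + h n \<le> h (Suc n)"
  using start_add_less[of i n "h n - 1"] h_pos[of n] by linarith

lemma start_add_cancel:
  assumes "start n i + k = start n j + k'" "k < h n" "k' < h n"
  shows "i = j \<and> k = k'"
proof (cases i j rule: linorder_cases)
  case less
  then show ?thesis using start_less[OF less, of n] assms by linarith
next
  case greater
  then show ?thesis using start_less[OF greater, of n] assms by linarith
qed (use assms in simp)

lemma h_mono: "n \<le> m \<Longrightarrow> h n \<le> h m"
  by (rule lift_Suc_mono_le[of h]) (auto simp: h_Suc)

lemma C_0: "C n ! 0 = 0"
proof (induction n)
  case 0
  then show ?case using columns by (simp add: rank_one_columns_def)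
next
  case (Suc n)
  then show ?case using nth_C_Suc[of 0 n 0] r_pos[of n] h_pos[of n] by simp
qed

lemma length_rank_one_word: "length (rank_one_word s n) = h n"
proof (induction n)
  case 0
  then show ?case using columns by (simp add: rank_one_columns_def)
next
  case (Suc n)
  then show ?case
    by (simp add: h_Suc start_def length_concat o_def sum_list_sum_nth length_s atLeast0LessThan
        sum.distrib)
qed

lemma L_disjoint: "\<lbrakk>x \<in> L n i; x \<in> L n j; i < h n; j < h n\<rbrakk> \<Longrightarrow> i = j"
  using columns unfolding rank_one_columns_def is_column_def disjoint_family_on_def by blast

lemma L_Suc_subset:
  assumes "i < r n" "k < h n" shows "L (Suc n) (start n i + k) \<subseteq> L n k"
proof
  fix x assume "x \<in> L (Suc n) (start n i + k)"
  then have "C n ! k + real i * w (Suc n) \<le> x" "x < C n ! k + real i * w (Suc n) + w (Suc n)"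
    using assms by (auto simp: mem_L nth_C_Suc)
  moreover have "real i * w (Suc n) + w (Suc n) \<le> w n"
  proof -
    have "(real i + 1) * w (Suc n) \<le> real (r n) * w (Suc n)"
      using assms w_pos[of "Suc n"] by (intro mult_right_mono) auto
    then show ?thesis by (simp add: w_Suc[of n] algebra_simps)
  qed
  moreover have "real i * w (Suc n) \<ge> 0" using w_pos[of "Suc n"] by simp
  ultimately show "x \<in> L n k" unfolding mem_L by linarith
qed

lemma L_Suc_cover:
  assumes "x \<in> L n k" "k < h n"
  obtains i where "i < r n" "x \<in> L (Suc n) (start n i + k)"
proof -
  define t where "t = (x - C n ! k) / w (Suc n)"
  have t: "x = C n ! k + t * w (Suc n)" using w_pos[of "Suc n"] by (simp add: t_def)
  have t0: "0 \<le> t" using assms w_pos[of "Suc n"] by (simp add: t_def mem_L)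
  have "t * w (Suc n) < real (r n) * w (Suc n)" using assms(1) t unfolding mem_L by (simp flip: w_Suc)
  then have "t < real (r n)" using w_pos[of "Suc n"] by simp
  define i where "i = nat \<lfloor>t\<rfloor>"
  have i: "real i \<le> t" "t < real i + 1" using t0 unfolding i_def by linarith+
  show thesis
  proof
    show ir: "i < r n" using i \<open>t < real (r n)\<close> by linarith
    have "real i * w (Suc n) \<le> t * w (Suc n)" "t * w (Suc n) < (real i + 1) * w (Suc n)"
      using i w_pos[of "Suc n"] by auto
    then show "x \<in> L (Suc n) (start n i + k)"
      unfolding mem_L nth_C_Suc[OF ir assms(2)] t by (simp add: algebra_simps)
  qed
qed

lemma L_later:
  assumes "n \<le> m" "x \<in> L n k" "k < h n"
  obtains l where "l < h m" "x \<in> L m l" "k \<le> l"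
proof -
  have "\<exists>l<h m. x \<in> L m l \<and> k \<le> l" using assms(1)
  proof (induction m rule: dec_induct)
    case (step m)
    then obtain l where l: "l < h m" "x \<in> L m l" "k \<le> l" by auto
    obtain i where "i < r m" "x \<in> L (Suc m) (start m i + l)" using l by (rule_tac L_Suc_cover)
    then show ?case using l start_add_less[of i m l] by (intro exI[of _ "start m i + l"]) auto
  qed (use assms in auto)
  then show thesis using that by auto
qed

lemma L_subset_X: "k < h n \<Longrightarrow> L n k \<subseteq> X"
  unfolding rank_one_space_def by auto

lemma in_late_level:
  assumes "x \<in> X"
  obtains n k where "k < h n" "x \<in> L n k" "N \<le> n"
proof -
  obtain n0 k0 where "k0 < h n0" "x \<in> L n0 k0" using assms by (auto simp: rank_one_space_def)
  then obtain l where "l < h (max n0 N)" "x \<in> L (max n0 N) l"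
    by (rule_tac L_later[of n0 "max n0 N" x k0]) auto
  then show thesis by (intro that[of l "max n0 N"]) auto
qed

section \<open>The transformation\<close>

text \<open>
  The jump that a column prescribes at one of its levels is prescribed by all later columns too:
  the partial maps extend one another.
\<close>

lemma step_later:
  assumes "n \<le> m" "x \<in> L n i" "Suc i < h n"
  shows "\<exists>j. Suc j < h m \<and> x \<in> L m j \<and> C m ! Suc j - C m ! j = C n ! Suc i - C n ! i"
  using assms(1)
proof (induction m rule: dec_induct)
  case (step m)
  then obtain j where j: "Suc j < h m" "x \<in> L m j" "C m ! Suc j - C m ! j = C n ! Suc i - C n ! i" by auto
  obtain l where l: "l < r m" "x \<in> L (Suc m) (start m l + j)"
    using j(1) by (rule_tac L_Suc_cover[OF j(2)]) auto
  show ?case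
    using l j start_add_less[of l m "Suc j"] nth_C_Suc[of l m j] nth_C_Suc[of l m "Suc j"]
    by (intro exI[of _ "start m l + j"]) auto
qed (use assms in auto)

lemma T_eq:
  assumes "x \<in> L n i" "Suc i < h n"
  shows "T x = x + (C n ! Suc i - C n ! i)"
proof -
  have "T x = C n ! Suc i + (x - C n ! i)"
    unfolding rank_one_map_def
  proof (rule the_equality)
    fix y assume "\<exists>n i. Suc i < h n \<and> x \<in> L n i \<and> y = C n ! Suc i + (x - C n ! i)"
    then obtain n' i' where *: "Suc i' < h n'" "x \<in> L n' i'" "y = C n' ! Suc i' + (x - C n' ! i')"
      by blast
    define m where "m = max n n'"
    obtain j where j: "Suc j < h m" "x \<in> L m j" "C m ! Suc j - C m ! j = C n ! Suc i - C n ! i"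
      using step_later[of n m x i] assms by (auto simp: m_def)
    obtain j' where j': "Suc j' < h m" "x \<in> L m j'" "C m ! Suc j' - C m ! j' = C n' ! Suc i' - C n' ! i'"
      using step_later[of n' m x i'] * by (auto simp: m_def)
    have "j = j'" using j j' by (intro L_disjoint[of x m]) auto
    then show "y = C n ! Suc i + (x - C n ! i)" using j j' * by simp
  qed (use assms in blast)
  then show ?thesis by simp
qed

lemma T_L:
  assumes "x \<in> L n i" "Suc i < h n"
  shows "T x \<in> L n (Suc i)"
  using assms T_eq[OF assms] by (auto simp: mem_L)

text \<open>
  The top levels of successive columns have a common right endpoint and lengths tending to zero.
  A point that stayed in them forever would have to be that endpoint, which belongs to none of them.
\<close>

lemma in_non_top_level:
  assumes "x \<in> X"
  obtains n i where "x \<in> L n i" "Suc i < h n" "N \<le> n"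
proof -
  obtain n0 k0 where 0: "k0 < h n0" "x \<in> L n0 k0" "N \<le> n0" by (rule in_late_level[OF assms])
  have "\<exists>n\<ge>n0. \<exists>i. x \<in> L n i \<and> Suc i < h n"
  proof (rule ccontr)
    assume "\<not> ?thesis"
    then have top: "\<And>n i. n \<ge> n0 \<Longrightarrow> x \<in> L n i \<Longrightarrow> h n \<le> Suc i" using not_less by blast
    have in_top: "x \<in> L n (h n - 1)" if n0: "n \<ge> n0" for n
    proof -
      obtain l where l: "l < h n" "x \<in> L n l" by (rule L_later[OF n0 0(2,1)])
      then have "l = h n - 1" using top[OF n0, of l] by auto
      then show ?thesis using l by simp
    qed
    have right_end: "C n ! (h n - 1) + w n = C n0 ! (h n0 - 1) + w n0" if "n \<ge> n0" for n
      using that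
    proof (induction n rule: dec_induct)
      case (step n)
      have "C (Suc n) ! (h (Suc n) - 1) = C n ! (h n - 1) + real (r n - 1) * w (Suc n)"
        using nth_C_Suc[of "r n - 1" n "h n - 1"] r_pos[of n] h_pos[of n] by (simp add: h_Suc)
      then show ?case using step w_Suc[of n] r_pos[of n] by (simp add: algebra_simps)
    qed simp
    have "x \<ge> C n0 ! (h n0 - 1) + w n0 - w n" if "n \<ge> n0" for n
      using in_top[OF that] right_end[OF that] by (auto simp: mem_L)
    then have "eventually (\<lambda>n. C n0 ! (h n0 - 1) + w n0 - w n \<le> x) sequentially"
      by (auto simp: eventually_sequentially)
    moreover have "(\<lambda>n. C n0 ! (h n0 - 1) + w n0 - w n) \<longlonglongrightarrow> C n0 ! (h n0 - 1) + w n0 - 0"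
      by (intro tendsto_intros w_tendsto_0)
    ultimately have "C n0 ! (h n0 - 1) + w n0 - 0 \<le> x"
      by (intro tendsto_upperbound[where F = sequentially]) auto
    then show False using in_top[of n0] by (auto simp: mem_L)
  qed
  then obtain n i where "n \<ge> n0" "x \<in> L n i" "Suc i < h n" by auto
  then show thesis using 0(3) by (intro that[of n i]) auto
qed

lemma inj_on_T: "inj_on T X"
proof (rule inj_onI)
  fix x y assume xy: "x \<in> X" "y \<in> X" "T x = T y"
  obtain n i where n: "x \<in> L n i" "Suc i < h n" "0 \<le> n" by (rule in_non_top_level[OF xy(1)])
  obtain m j where m: "y \<in> L m j" "Suc j < h m" "n \<le> m" by (rule in_non_top_level[OF xy(2)])
  obtain i' where i': "Suc i' < h m" "x \<in> L m i'" using step_later[OF m(3) n(1,2)] by auto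
  have "Suc i' = Suc j"
    using T_L[OF m(1,2)] T_L[OF i'(2,1)] xy m i' by (intro L_disjoint[of "T x" m]) auto
  then show "x = y" using T_eq[OF m(1,2)] T_eq[OF i'(2,1)] xy by simp
qed

lemma inv_T_eq:
  assumes "x \<in> L n (Suc i)" "Suc i < h n"
  shows "inv_into X T x = x + (C n ! i - C n ! Suc i)" "inv_into X T x \<in> L n i"
proof -
  define y where "y = x + (C n ! i - C n ! Suc i)"
  have y: "y \<in> L n i" using assms by (auto simp: mem_L y_def)
  have "T y = x" using T_eq[OF y assms(2)] by (simp add: y_def)
  then have "inv_into X T x = y"
    using inv_into_f_f[OF inj_on_T, of y] y assms L_subset_X[of i n] by auto
  then show "inv_into X T x = x + (C n ! i - C n ! Suc i)" "inv_into X T x \<in> L n i"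
    using y by (auto simp: y_def)
qed

definition left_ends :: "real set" where
  "left_ends = (\<Union>n. set (C n))"

lemma countable_left_ends: "countable left_ends"
  unfolding left_ends_def by (intro countable_UN) (auto intro: countable_finite)

text \<open>
  A point that lies in the leftmost subcolumn from some stage on is the left endpoint of its level.
  Any other point moves to a higher level infinitely often, so that the columns contain arbitrarily
  long pieces of its past.
\<close>

lemma high_level:
  assumes "x \<in> X" "x \<notin> left_ends"
  obtains m l where "N \<le> m" "l < h m" "H \<le> l" "x \<in> L m l"
proof -
  have "\<exists>m\<ge>N. \<exists>l<h m. H \<le> l \<and> x \<in> L m l"
  proof (induction H)
    case 0
    obtain m l where "l < h m" "x \<in> L m l" "N \<le> m" by (rule in_late_level[OF assms(1)])
    then show ?case by auto
  next
    case (Suc H)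
    then obtain m l where ml: "m \<ge> N" "l < h m" "H \<le> l" "x \<in> L m l" by blast
    show ?case
    proof (rule ccontr)
      assume no: "\<not> ?case"
      have "x \<in> L n l \<and> C n ! l = C m ! l" if "n \<ge> m" for n using that
      proof (induction n rule: dec_induct)
        case (step n)
        have ln: "l < h n" using ml h_mono[OF step(1)] by simp
        obtain i where i: "i < r n" "x \<in> L (Suc n) (start n i + l)"
          using ln step by (rule_tac L_Suc_cover) auto
        have "i = 0"
        proof (rule ccontr)
          assume "i \<noteq> 0"
          then have "start n i \<ge> 1" using start_less[of 0 i n] h_pos[of n] by (simp add: Suc_le_eq
                del: length_greater_0_conv)
          then show False using no i start_add_less[OF i(1) ln] ml step by (auto dest!: spec[of _ "Suc n"])
        qed
        then show ?case using i nth_C_Suc[OF i(1) ln] step by simp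
      qed (use ml in auto)
      then have "x \<le> C m ! l + w n" if "n \<ge> m" for n using that by (metis less_imp_le mem_L)
      then have "eventually (\<lambda>n. x \<le> C m ! l + w n) sequentially"
        by (auto simp: eventually_sequentially)
      moreover have "(\<lambda>n. C m ! l + w n) \<longlonglongrightarrow> C m ! l + 0"
        by (intro tendsto_intros w_tendsto_0)
      ultimately have "x \<le> C m ! l + 0"
        by (intro tendsto_lowerbound[where F = sequentially]) auto
      then have "x = C m ! l" using ml by (auto simp: mem_L)
      then show False using assms nth_mem[OF ml(2)] unfolding left_ends_def by blast
    qed
  qed
  then show thesis using that by auto
qed

section \<open>Positions of earlier columns inside later ones\<close>

text \<open>
  The heights in \<open>C m\<close> at which the copies of \<open>C a\<close> begin, or equivalently (\<open>mem_base_iff\<close>) the levels of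
  \<open>C m\<close> that lie in the base of \<open>C a\<close>. In terms of the rank-one words, these are the starting
  positions of the expected occurrences of the word of stage \<open>a\<close> in that of stage \<open>m\<close>. The value for
  \<open>m < a\<close> is a dummy.
\<close>

primrec copies :: "nat \<Rightarrow> nat \<Rightarrow> nat set" where
  "copies a 0 = {0}"
| "copies a (Suc m) = (if m < a then {0} else (\<Union>i<r m. (+) (start m i) ` copies a m))"

lemma copies_self [simp]: "copies a a = {0}"
  by (cases a) auto

lemma copies_Suc:
  "a \<le> m \<Longrightarrow> t \<in> copies a (Suc m) \<longleftrightarrow> (\<exists>i<r m. \<exists>k\<in>copies a m. t = start m i + k)"
  by auto

declare copies.simps(2) [simp del]

lemma finite_copies: "finite (copies a m)"
  by (induction m) (auto simp: copies.simps)

lemma copies_bound: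
  assumes "a \<le> m" "t \<in> copies a m" shows "t + h a \<le> h m"
  using assms
proof (induction m arbitrary: t rule: dec_induct)
  case (step m)
  then obtain i k where "i < r m" "k \<in> copies a m" "t = start m i + k" by (auto simp: copies_Suc)
  then show ?case using step.IH[of k] start_add_le[of i m] by simp
qed simp

lemma copies_less: "a \<le> m \<Longrightarrow> t \<in> copies a m \<Longrightarrow> t < h m"
  using copies_bound[of a m t] h_pos[of a] by linarith

lemma mem_base_iff:
  assumes "a \<le> m" "t < h m" "x \<in> L m t"
  shows "x \<in> L a 0 \<longleftrightarrow> t \<in> copies a m"
  using assms
proof (induction m arbitrary: t rule: dec_induct)
  case base
  then show ?case using L_disjoint[of x a t 0] h_pos[of a] by auto
next
  case (step m)
  show ?case
  proof
    assume "x \<in> L a 0"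
    then obtain k where k: "k < h m" "x \<in> L m k" by (rule L_later[OF step(1) _ h_pos])
    obtain i where i: "i < r m" "x \<in> L (Suc m) (start m i + k)" by (rule L_Suc_cover[OF k(2,1)])
    have "t = start m i + k"
      using i k step.prems start_add_less by (intro L_disjoint[of x "Suc m"]) auto
    then show "t \<in> copies a (Suc m)"
      using i k step.IH[OF k] \<open>x \<in> L a 0\<close> step(1) by (auto simp: copies_Suc)
  next
    assume "t \<in> copies a (Suc m)"
    then obtain i k where *: "i < r m" "k \<in> copies a m" "t = start m i + k"
      using step(1) by (auto simp: copies_Suc)
    have "k < h m" using copies_less step(1) * by blast
    then show "x \<in> L a 0" using step.IH[of k] L_Suc_subset[of i m k] * step.prems by auto
  qed
qed

lemma card_copies_Suc:
  assumes "a \<le> m" shows "card (copies a (Suc m)) = r m * card (copies a m)"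
proof -
  have "copies a (Suc m) = (\<lambda>(i, k). start m i + k) ` ({..<r m} \<times> copies a m)"
    using assms by (force simp: copies_Suc)
  moreover have "inj_on (\<lambda>(i, k). start m i + k) ({..<r m} \<times> copies a m)"
    by (auto simp: inj_on_def dest: start_add_cancel copies_less[OF assms])
  ultimately show ?thesis by (simp add: card_image card_cartesian_product)
qed

lemma card_copies_width: "a \<le> m \<Longrightarrow> real (card (copies a m)) * w m = w a"
proof (induction m rule: dec_induct)
  case (step m)
  then show ?case using w_Suc[of m] by (simp add: card_copies_Suc algebra_simps)
qed simp

lemma copies_trans:
  assumes "a \<le> b" "b \<le> m"
  shows "t \<in> copies a m \<longleftrightarrow> (\<exists>u\<in>copies b m. \<exists>k\<in>copies a b. t = u + k)"
  using assms(2)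
proof (induction m arbitrary: t rule: dec_induct)
  case (step m)
  have "a \<le> m" using assms step by simp
  show ?case
  proof
    assume "t \<in> copies a (Suc m)"
    then obtain i t' where "i < r m" "t' \<in> copies a m" "t = start m i + t'"
      unfolding copies_Suc[OF \<open>a \<le> m\<close>] by blast
    moreover from this obtain u k where "u \<in> copies b m" "k \<in> copies a b" "t' = u + k"
      using step.IH by blast
    ultimately have "i < r m" "u \<in> copies b m" "k \<in> copies a b" "t = start m i + (u + k)"
      by auto
    moreover from this have "start m i + u \<in> copies b (Suc m)"
      unfolding copies_Suc[OF step(1)] by blast
    ultimately show "\<exists>u\<in>copies b (Suc m). \<exists>k\<in>copies a b. t = u + k"
      by (metis add.assoc)
  next
    assume "\<exists>u\<in>copies b (Suc m). \<exists>k\<in>copies a b. t = u + k"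
    then obtain v k where "v \<in> copies b (Suc m)" "k \<in> copies a b" "t = v + k" by blast
    moreover from this obtain i u where "i < r m" "u \<in> copies b m" "v = start m i + u"
      unfolding copies_Suc[OF step(1)] by blast
    ultimately have "i < r m" "u \<in> copies b m" "k \<in> copies a b" "t = start m i + (u + k)"
      by auto
    moreover from this have "u + k \<in> copies a m"
      using step.IH by blast
    ultimately show "t \<in> copies a (Suc m)"
      unfolding copies_Suc[OF \<open>a \<le> m\<close>] by blast
  qed
qed simp

section \<open>Measure of the levels\<close>

lemma sets_L [measurable]: "L n i \<in> sets lebesgue"
  by (simp add: level_def)

lemma emeasure_L: "emeasure lebesgue (L n i) = ennreal (w n)"
  using w_pos[of n] by (simp add: level_def)

lemma sets_X [measurable]: "X \<in> sets lebesgue"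
  unfolding rank_one_space_def by measurable

lemma disjoint_L: "I \<subseteq> {..<h n} \<Longrightarrow> disjoint_family_on (L n) I"
  unfolding disjoint_family_on_def using L_disjoint[of _ n] by blast

lemma null_left_ends: "left_ends \<in> null_sets lebesgue"
  using countable_imp_null_set_lborel[OF countable_left_ends] null_sets_completionI by blast

text \<open>
  The base \<open>L m 0\<close> begins at \<open>0\<close>, so \<open>x + C m ! j\<close> is the point above \<open>x\<close> at height \<open>j\<close>. Integrating
  the number of visits to \<open>F\<close> over the base gives the measure of the part of \<open>F\<close> in the column, so
  the visits cannot be numerous from almost every starting point.
\<close>

lemma few_visits:
  assumes F: "F \<in> sets lebesgue" and small: "emeasure lebesgue F < ennreal (K * w m)"
    and generic: "AE x in lebesgue. P x"
  obtains x where "x \<in> L m 0" "P x" "real (card {j. j < h m \<and> x + C m ! j \<in> F}) < K"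
proof -
  have "\<exists>x\<in>L m 0. P x \<and> real (card {j. j < h m \<and> x + C m ! j \<in> F}) < K"
  proof (rule ccontr)
    assume "\<not> ?thesis"
    then have many: "AE x in lebesgue. x \<in> L m 0 \<longrightarrow> K \<le> real (card {j. j < h m \<and> x + C m ! j \<in> F})"
      using generic by (auto elim!: eventually_mono simp: not_less)
    define V where "V j = (\<lambda>x. C m ! j + 1 * x) -` (F \<inter> L m j)" for j
    have V: "V j \<in> sets lebesgue" "emeasure lebesgue (V j) = emeasure lebesgue (F \<inter> L m j)" for j
      using sets_isometry_vimage[of 1 "F \<inter> L m j" "C m ! j"]
        emeasure_isometry_vimage[of 1 "F \<inter> L m j" "C m ! j"] F by (auto simp: V_def)
    have V_iff: "x \<in> V j \<longleftrightarrow> x \<in> L m 0 \<and> x + C m ! j \<in> F" for x j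
      by (auto simp: V_def mem_L C_0 add.commute)
    have "ennreal (K * w m) = (\<integral>\<^sup>+x. ennreal K * indicator (L m 0) x \<partial>lebesgue)"
      using w_pos[of m] by (simp add: nn_integral_cmult_indicator emeasure_L ennreal_mult'')
    also have "\<dots> \<le> (\<integral>\<^sup>+x. (\<Sum>j<h m. indicator (V j) x) \<partial>lebesgue)"
    proof (rule nn_integral_mono_AE)
      have "(\<Sum>j<h m. indicator (V j) x) = (of_nat (card {j. j < h m \<and> x + C m ! j \<in> F}) :: ennreal)"
        if "x \<in> L m 0" for x
      proof -
        have "(\<Sum>j<h m. indicator (V j) x) = (\<Sum>j<h m. if x + C m ! j \<in> F then 1 else 0 :: ennreal)"
          using that by (intro sum.cong) (auto simp: V_iff indicator_def)
        also have "\<dots> = of_nat (card {j. j < h m \<and> x + C m ! j \<in> F})"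
          by (simp add: sum.If_cases Int_def)
        finally show ?thesis .
      qed
      then show "AE x in lebesgue. ennreal K * indicator (L m 0) x \<le> (\<Sum>j<h m. indicator (V j) x)"
        using many by (auto elim!: eventually_mono split: split_indicator
            simp: ennreal_of_nat_eq_real_of_nat intro!: ennreal_leI)
    qed
    also have "\<dots> = (\<Sum>j<h m. emeasure lebesgue (F \<inter> L m j))"
      using V by (subst nn_integral_sum) auto
    also have "\<dots> = emeasure lebesgue (\<Union>j<h m. F \<inter> L m j)"
      using F disjoint_L[of "{..<h m}" m] by (intro sum_emeasure) (auto simp: disjoint_family_on_def)
    also have "\<dots> \<le> emeasure lebesgue F"
      using F by (intro emeasure_mono) auto
    finally show False using small by simp
  qed
  then show thesis using that by blast
qed

text \<open>
  An open set containing \<open>E\<close> with little excess is, inside the space, the increasing union of the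
  levels of \<open>C n\<close> that it contains, because the lengths of the levels tend to zero.
\<close>

lemma approximation_by_levels:
  assumes E: "E \<in> sets lebesgue" "E \<subseteq> X" "emeasure lebesgue E < \<infinity>" and "0 < e"
  shows "\<exists>N. \<forall>n\<ge>N. \<exists>I\<subseteq>{..<h n}. emeasure lebesgue ((\<Union>k\<in>I. L n k) - E) < ennreal e
    \<and> emeasure lebesgue (E - (\<Union>k\<in>I. L n k)) < ennreal e"
proof -
  obtain G where G: "open G" "E \<subseteq> G" "G - E \<in> lmeasurable" "emeasure lebesgue (G - E) < ennreal e"
    using sets_lebesgue_outer_open[OF E(1) \<open>0 < e\<close>] by metis
  define I where "I n = {k. k < h n \<and> L n k \<subseteq> G}" for n
  define U where "U n = (\<Union>k\<in>I n. L n k)" for n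
  have sets_U: "U n \<in> sets lebesgue" for n
    unfolding U_def by (intro sets.finite_UN) (auto simp: I_def)
  have U_G: "U n \<subseteq> G" for n by (auto simp: U_def I_def)
  have "incseq U"
  proof (rule incseq_SucI, rule subsetI)
    fix n x assume "x \<in> U n"
    then obtain k where k: "k < h n" "L n k \<subseteq> G" "x \<in> L n k" by (auto simp: U_def I_def)
    obtain i where "i < r n" "x \<in> L (Suc n) (start n i + k)" by (rule L_Suc_cover[OF k(3,1)])
    then show "x \<in> U (Suc n)"
      using k L_Suc_subset[of i n k] start_add_less[of i n k] unfolding U_def I_def by blast
  qed
  have "x \<in> (\<Union>n. U n)" if x: "x \<in> E" for x
  proof -
    obtain d where d: "0 < d" "\<And>y. dist y x < d \<Longrightarrow> y \<in> G"
      using G x unfolding open_dist by blast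
    have "eventually (\<lambda>n. w n < d) sequentially"
      using w_tendsto_0 d(1) by (rule order_tendstoD)
    then obtain n0 where n0: "\<And>n. n \<ge> n0 \<Longrightarrow> w n < d" by (auto simp: eventually_sequentially)
    have "x \<in> X" using x E by auto
    then obtain n k where nk: "k < h n" "x \<in> L n k" "n0 \<le> n" by (rule in_late_level)
    have "L n k \<subseteq> G"
    proof
      fix y assume "y \<in> L n k"
      then have "dist y x < d" using nk(2) n0[OF nk(3)] by (auto simp: mem_L dist_real_def)
      then show "y \<in> G" by (rule d(2))
    qed
    then show ?thesis using nk by (auto simp: U_def I_def)
  qed
  then have empty: "(\<Inter>n. E - U n) = {}" by auto
  have fin: "emeasure lebesgue (E - U n) \<noteq> \<infinity>" for n
    using emeasure_mono[of "E - U n" E lebesgue] E by (auto simp: top_unique)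
  have "(\<lambda>n. emeasure lebesgue (E - U n)) \<longlonglongrightarrow> emeasure lebesgue (\<Inter>n. E - U n)"
  proof (rule Lim_emeasure_decseq)
    show "decseq (\<lambda>n. E - U n)"
      using \<open>incseq U\<close> unfolding decseq_def incseq_def by blast
  qed (use E sets_U fin in auto)
  then have "eventually (\<lambda>n. emeasure lebesgue (E - U n) < ennreal e) sequentially"
    unfolding empty using \<open>0 < e\<close> by (intro order_tendstoD) auto
  then obtain N where N: "\<And>n. n \<ge> N \<Longrightarrow> emeasure lebesgue (E - U n) < ennreal e"
    by (auto simp: eventually_sequentially)
  have "emeasure lebesgue (U n - E) < ennreal e" for n
    using emeasure_mono[of "U n - E" "G - E" lebesgue] U_G[of n] G E by (auto intro: le_less_trans)
  then show ?thesis
    using N by (intro exI[of _ N] allI impI exI[of _ "I n" for n]) (auto simp: U_def I_def)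
qed

section \<open>Reflecting palindromic columns\<close>

lemma left_end_later: "m \<le> n \<Longrightarrow> l < h m \<Longrightarrow> C n ! l = C m ! l"
proof (induction n rule: dec_induct)
  case (step n)
  then have "l < h n" using h_mono[OF step(1)] by simp
  then show ?case using nth_C_Suc[of 0 n l] r_pos[of n] step by simp
qed simp

text \<open>
  Left endpoints persist: as leftmost pieces are stacked first, a left endpoint keeps its height in
  all later columns and is never interior to a level there.
\<close>

lemma left_end_of_level:
  assumes "x \<in> left_ends"
  obtains m where "\<And>n j. m \<le> n \<Longrightarrow> j < h n \<Longrightarrow> x \<in> L n j \<Longrightarrow> x = C n ! j"
proof -
  obtain m l where ml: "l < h m" "x = C m ! l"
    using assms by (auto simp: left_ends_def in_set_conv_nth)
  have "x = C n ! j" if n: "m \<le> n" "j < h n" "x \<in> L n j" for n j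
  proof -
    have e: "x = C n ! l" using left_end_later[OF n(1) ml(1)] ml by simp
    then have "x \<in> L n l" using w_pos[of n] by (simp add: mem_L)
    then have "l = j" using n ml(1) h_mono[OF n(1)] by (intro L_disjoint[of x n]) auto
    then show ?thesis using e by simp
  qed
  then show thesis by (rule that)
qed

lemma L_interior:
  assumes "x \<in> L n i" "i < h n" "x \<notin> left_ends" shows "C n ! i < x"
proof -
  have "x \<noteq> C n ! i" using assms nth_mem[OF assms(2)] unfolding left_ends_def by blast
  then show ?thesis using assms by (simp add: mem_L)
qed

text \<open>
  On level \<open>i\<close> of \<open>C n\<close> the map is the reflection onto level \<open>h n - 1 - i\<close>. It would send a left
  endpoint to a right endpoint, which does not belong to the level; left endpoints are fixed
  instead. For palindromic spacers the reflections at different stages coincide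
  (\<open>reflection_centre_later\<close>), so that the description determines a value.
\<close>

definition flip :: "nat \<Rightarrow> real \<Rightarrow> real" where
  "flip N x = (if x \<in> X - left_ends
     then THE y. \<exists>n\<ge>N. \<exists>i<h n. x \<in> L n i \<and> y = C n ! i + C n ! (h n - 1 - i) + w n - x
     else x)"

context
  fixes N :: nat
  assumes palindromic: "\<And>n. N \<le> n \<Longrightarrow> s n = rev (s n)"
begin

lemma start_reflect:
  assumes "N \<le> n" "i < r n" shows "start n i + start n (r n - 1 - i) = start n (r n - 1)"
  using assms(2)
proof (induction i)
  case (Suc i)
  then have i: "i < length (s n)" by (simp add: length_s)
  have e: "r n - 1 - i = Suc (r n - 1 - Suc i)" using Suc by simp
  have "s n ! i = s n ! (r n - 1 - Suc i)"
    using arg_cong[OF palindromic[OF assms(1)], of "\<lambda>xs. xs ! i"] i by (simp add: rev_nth length_s)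
  then show ?case using Suc unfolding e by (simp add: start_Suc)
qed simp

text \<open>
  The point lies in subcolumn \<open>l\<close> of some level \<open>j\<close>, and the level opposite to it in \<open>C (Suc m)\<close> is
  subcolumn \<open>r m - 1 - l\<close> of the opposite level \<open>h m - 1 - j\<close> by \<open>start_reflect\<close>. The shifts of the two
  subcolumns within their levels add up to \<open>w m - w (Suc m)\<close>, which makes up for the shorter levels.
\<close>

lemma reflection_centre_later:
  assumes "N \<le> n" "n \<le> m" "x \<in> L n i" "i < h n"
  shows "\<exists>j<h m. x \<in> L m j \<and>
    C m ! j + C m ! (h m - 1 - j) + w m = C n ! i + C n ! (h n - 1 - i) + w n"
  using assms(2)
proof (induction m rule: dec_induct)
  case (step m)
  then obtain j where j: "j < h m" "x \<in> L m j"
    "C m ! j + C m ! (h m - 1 - j) + w m = C n ! i + C n ! (h n - 1 - i) + w n" by auto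
  obtain l where l: "l < r m" "x \<in> L (Suc m) (start m l + j)" by (rule L_Suc_cover[OF j(2,1)])
  have less: "start m l + j < h (Suc m)" by (rule start_add_less[OF l(1) j(1)])
  have "h (Suc m) - 1 - (start m l + j) = start m (r m - 1 - l) + (h m - 1 - j)"
    using start_reflect[of m l] step(1) assms(1) l j by (simp add: h_Suc)
  moreover have "C (Suc m) ! (start m (r m - 1 - l) + (h m - 1 - j))
      = C m ! (h m - 1 - j) + real (r m - 1 - l) * w (Suc m)"
    using l j by (intro nth_C_Suc) auto
  moreover have "real l * w (Suc m) + real (r m - 1 - l) * w (Suc m) + w (Suc m) = w m"
  proof -
    have "real l + real (r m - 1 - l) + 1 = real (r m)" using l by simp
    then show ?thesis by (metis w_Suc distrib_right mult_1)
  qed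
  ultimately show ?case
    using j(3) less l nth_C_Suc[OF l(1) j(1)] by (intro exI[of _ "start m l + j"]) simp
qed (use assms in auto)

lemma flip_eq:
  assumes "N \<le> n" "i < h n" "x \<in> L n i" "x \<notin> left_ends"
  shows "flip N x = C n ! i + C n ! (h n - 1 - i) + w n - x"
proof -
  have "x \<in> X - left_ends" using assms L_subset_X by blast
  moreover have "(THE y. \<exists>n\<ge>N. \<exists>i<h n. x \<in> L n i \<and> y = C n ! i + C n ! (h n - 1 - i) + w n - x)
      = C n ! i + C n ! (h n - 1 - i) + w n - x"
  proof (rule the_equality)
    fix y assume "\<exists>n\<ge>N. \<exists>i<h n. x \<in> L n i \<and> y = C n ! i + C n ! (h n - 1 - i) + w n - x"
    then obtain n' i' where *: "n' \<ge> N" "i' < h n'" "x \<in> L n' i'"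
      "y = C n' ! i' + C n' ! (h n' - 1 - i') + w n' - x" by blast
    define m where "m = max n n'"
    obtain j where j: "j < h m" "x \<in> L m j"
      "C m ! j + C m ! (h m - 1 - j) + w m = C n ! i + C n ! (h n - 1 - i) + w n"
      using reflection_centre_later[of n m x i] assms by (auto simp: m_def)
    obtain j' where j': "j' < h m" "x \<in> L m j'"
      "C m ! j' + C m ! (h m - 1 - j') + w m = C n' ! i' + C n' ! (h n' - 1 - i') + w n'"
      using reflection_centre_later[of n' m x i'] * by (auto simp: m_def)
    have "j = j'" using j j' by (intro L_disjoint[of x m]) auto
    then show "y = C n ! i + C n ! (h n - 1 - i) + w n - x" using j j' * by simp
  qed (use assms in blast)
  ultimately show ?thesis by (simp add: flip_def)
qed

lemma flip_interior:
  assumes "N \<le> n" "i < h n" "x \<in> L n i" "x \<notin> left_ends"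
  shows "C n ! (h n - 1 - i) < flip N x" "flip N x \<in> L n (h n - 1 - i)"
  using flip_eq[OF assms] L_interior[OF assms(3,2,4)] assms(3) by (auto simp: mem_L)

lemma flip_not_left_end:
  assumes "x \<in> X" "x \<notin> left_ends" shows "flip N x \<notin> left_ends"
proof
  assume "flip N x \<in> left_ends"
  then obtain m where m: "\<And>n j. m \<le> n \<Longrightarrow> j < h n \<Longrightarrow> flip N x \<in> L n j \<Longrightarrow> flip N x = C n ! j"
    using left_end_of_level by blast
  obtain n i where n: "i < h n" "x \<in> L n i" "max m N \<le> n" by (rule in_late_level[OF assms(1)])
  then show False
    using flip_interior[of n i x] assms(2) m[of n "h n - 1 - i"] h_pos[of n] by simp
qed

lemma flip_flip:
  assumes "x \<in> X" "x \<notin> left_ends" shows "flip N (flip N x) = x"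
proof -
  obtain n i where n: "i < h n" "x \<in> L n i" "N \<le> n" by (rule in_late_level[OF assms(1)])
  have "h n - 1 - (h n - 1 - i) = i" using n by simp
  then show ?thesis
    using flip_eq[OF n(3) _ flip_interior(2)[OF n(3,1,2) assms(2)] flip_not_left_end[OF assms]]
      flip_eq[OF n(3,1,2) assms(2)] n(1) by simp
qed

lemma flip_reverses:
  assumes "x \<in> X" "x \<notin> left_ends" shows "flip N (T x) = inv_into X T (flip N x)"
proof -
  have T_not_left_end: "T x \<notin> left_ends"
  proof
    assume "T x \<in> left_ends"
    then obtain m where m: "\<And>n j. m \<le> n \<Longrightarrow> j < h n \<Longrightarrow> T x \<in> L n j \<Longrightarrow> T x = C n ! j"
      using left_end_of_level by blast
    obtain n i where n: "x \<in> L n i" "Suc i < h n" "m \<le> n" by (rule in_non_top_level[OF assms(1)])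
    then have "x = C n ! i" using m[OF n(3,2) T_L[OF n(1,2)]] T_eq[OF n(1,2)] by simp
    then show False using L_interior[OF n(1) _ assms(2)] n(2) by simp
  qed
  obtain n i where n: "x \<in> L n i" "Suc i < h n" "N \<le> n" by (rule in_non_top_level[OF assms(1)])
  have e: "h n - 1 - i = Suc (h n - 1 - Suc i)" using n(2) by simp
  have "flip N (T x) = C n ! Suc i + C n ! (h n - 1 - Suc i) + w n - T x"
    using n by (intro flip_eq T_L T_not_left_end) auto
  moreover have "flip N x = C n ! i + C n ! (h n - 1 - i) + w n - x"
    using n assms by (intro flip_eq) auto
  moreover have "flip N x \<in> L n (h n - 1 - i)"
    using n assms by (intro flip_interior) auto
  then have "inv_into X T (flip N x)
      = flip N x + (C n ! (h n - 1 - Suc i) - C n ! Suc (h n - 1 - Suc i))"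
    unfolding e using n(2) by (intro inv_T_eq(1)) auto
  ultimately show ?thesis using T_eq[OF n(1,2)] unfolding e by simp
qed

text \<open>
  Within \<open>C n\<close> the map permutes the levels by isometries, so it preserves the measure there; the
  columns exhaust the space.
\<close>

lemma flip_preserves_measure_off_left_ends:
  assumes A: "A \<in> sets lebesgue" "A \<subseteq> X - left_ends"
  shows "flip N -` A \<inter> (X - left_ends) \<in> sets lebesgue" (is ?s)
    and "emeasure lebesgue (flip N -` A \<inter> (X - left_ends)) = emeasure lebesgue A" (is ?e)
proof -
  define D where "D n = (\<Union>i<h n. L n i)" for n
  define F where "F n i = (\<lambda>x. (C n ! i + C n ! (h n - 1 - i) + w n) + (-1) * x) -`
    (A \<inter> L n (h n - 1 - i))" for n i
  have F: "F n i \<in> sets lebesgue" "emeasure lebesgue (F n i) = emeasure lebesgue (A \<inter> L n (h n - 1 - i))"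
    for n i
  proof -
    have "A \<inter> L n (h n - 1 - i) \<in> sets lebesgue" using A by auto
    then show "F n i \<in> sets lebesgue"
      "emeasure lebesgue (F n i) = emeasure lebesgue (A \<inter> L n (h n - 1 - i))"
      unfolding F_def by (rule sets_isometry_vimage[rotated] emeasure_isometry_vimage[rotated], simp)+
  qed
  define G where "G n = flip N -` A \<inter> (X - left_ends) \<inter> D n" for n
  have F_eq: "F n i = flip N -` A \<inter> (X - left_ends) \<inter> L n i" if n: "N \<le> n" "i < h n" for n i
  proof (intro equalityI subsetI)
    fix x assume "x \<in> F n i"
    define y where "y = C n ! i + C n ! (h n - 1 - i) + w n - x"
    have y: "y \<in> A" "y \<in> L n (h n - 1 - i)"
      using \<open>x \<in> F n i\<close> by (auto simp: F_def y_def)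
    have yX: "y \<in> X" "y \<notin> left_ends" using y A by auto
    have ii: "h n - 1 - i < h n" "h n - 1 - (h n - 1 - i) = i" using n by auto
    have "flip N y = x"
      using flip_eq[OF n(1) ii(1) y(2) yX(2)] ii by (simp add: y_def)
    then show "x \<in> flip N -` A \<inter> (X - left_ends) \<inter> L n i"
      using flip_interior(2)[OF n(1) ii(1) y(2) yX(2)] flip_not_left_end[OF yX] flip_flip[OF yX]
        y ii n L_subset_X[of i n] by auto
  next
    fix x assume x: "x \<in> flip N -` A \<inter> (X - left_ends) \<inter> L n i"
    then show "x \<in> F n i"
      using flip_eq[OF n, of x] flip_interior(2)[OF n, of x] by (auto simp: F_def)
  qed
  have G: "G n \<in> sets lebesgue" "emeasure lebesgue (G n) = emeasure lebesgue (A \<inter> D n)"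
    if n: "N \<le> n" for n
  proof -
    have G_F: "G n = (\<Union>i<h n. F n i)" using F_eq[OF n] by (auto simp: G_def D_def)
    show "G n \<in> sets lebesgue" unfolding G_F using F by auto
    have "emeasure lebesgue (G n) = (\<Sum>i<h n. emeasure lebesgue (F n i))"
      unfolding G_F
    proof (intro sum_emeasure[symmetric])
      show "disjoint_family_on (F n) {..<h n}"
        using disjoint_L[of "{..<h n}" n] F_eq[OF n] by (fastforce simp: disjoint_family_on_def)
    qed (use F in auto)
    also have "\<dots> = (\<Sum>i<h n. emeasure lebesgue (A \<inter> L n i))"
      unfolding F(2) using sum.nat_diff_reindex[of "\<lambda>i. emeasure lebesgue (A \<inter> L n i)" "h n"] by simp
    also have "\<dots> = emeasure lebesgue (\<Union>i<h n. A \<inter> L n i)"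
      using A disjoint_L[of "{..<h n}" n] by (intro sum_emeasure) (auto simp: disjoint_family_on_def)
    also have "(\<Union>i<h n. A \<inter> L n i) = A \<inter> D n" by (auto simp: D_def)
    finally show "emeasure lebesgue (G n) = emeasure lebesgue (A \<inter> D n)" .
  qed
  have D_mono: "D n \<subseteq> D m" if nm: "n \<le> m" for n m
  proof
    fix x assume "x \<in> D n"
    then obtain k where k: "k < h n" "x \<in> L n k" by (auto simp: D_def)
    obtain l where "l < h m" "x \<in> L m l" by (rule L_later[OF nm k(2,1)])
    then show "x \<in> D m" by (auto simp: D_def)
  qed
  have D_X: "\<exists>n. x \<in> D (n + N)" if x: "x \<in> X" for x
  proof -
    obtain n k where "k < h n" "x \<in> L n k" "N \<le> n" by (rule in_late_level[OF x])
    then show ?thesis by (intro exI[of _ "n - N"]) (auto simp: D_def)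
  qed
  have D_sets: "D n \<in> sets lebesgue" for n by (auto simp: D_def)
  have Un_G: "flip N -` A \<inter> (X - left_ends) = (\<Union>n. G (n + N))"
    using D_X by (auto simp: G_def)
  have Un_A: "A = (\<Union>n. A \<inter> D (n + N))" using D_X A(2) by auto
  have "incseq (\<lambda>n. A \<inter> D (n + N))"
    using D_mono unfolding incseq_def by (meson Int_mono add_le_mono1 order_refl)
  have "incseq (\<lambda>n. G (n + N))"
    using D_mono unfolding incseq_def G_def by (meson Int_mono add_le_mono1 order_refl)
  show ?s unfolding Un_G using G(1) by auto
  have "emeasure lebesgue (flip N -` A \<inter> (X - left_ends)) = (SUP n. emeasure lebesgue (G (n + N)))"
    unfolding Un_G using G(1) \<open>incseq (\<lambda>n. G (n + N))\<close>
    by (intro SUP_emeasure_incseq[symmetric]) auto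
  also have "\<dots> = (SUP n. emeasure lebesgue (A \<inter> D (n + N)))" using G(2) by simp
  also have "\<dots> = emeasure lebesgue (\<Union>n. A \<inter> D (n + N))"
    using A D_sets \<open>incseq (\<lambda>n. A \<inter> D (n + N))\<close> by (intro SUP_emeasure_incseq) auto
  finally show ?e unfolding Un_A[symmetric] .
qed

lemma flip_preserves_measure: "measure_preserving_map (lebesgue_on X) (lebesgue_on X) (flip N)"
proof -
  have flip_X: "flip N x \<in> X" if x: "x \<in> X" for x
  proof (cases "x \<in> left_ends")
    case False
    obtain n i where n: "i < h n" "x \<in> L n i" "N \<le> n" by (rule in_late_level[OF x])
    then show ?thesis
      using flip_interior(2)[OF n(3,1,2) False] L_subset_X[of "h n - 1 - i" n] h_pos[of n]
      by (auto simp del: length_greater_0_conv)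
  qed (use x in \<open>simp add: flip_def\<close>)
  have main: "flip N -` A \<inter> X \<in> sets lebesgue \<and> emeasure lebesgue (flip N -` A \<inter> X) = emeasure lebesgue A"
    if A: "A \<in> sets lebesgue" "A \<subseteq> X" for A
  proof -
    have Z: "A \<inter> left_ends \<in> null_sets lebesgue"
      using null_left_ends A by (intro null_set_Int1) auto
    have A': "A - left_ends \<in> sets lebesgue" "A - left_ends \<subseteq> X - left_ends"
      using A null_left_ends by (auto simp: null_sets_def)
    have split: "flip N -` A \<inter> X = (flip N -` (A - left_ends) \<inter> (X - left_ends)) \<union> (A \<inter> left_ends)"
    proof (rule set_eqI)
      fix x
      show "x \<in> flip N -` A \<inter> X
          \<longleftrightarrow> x \<in> (flip N -` (A - left_ends) \<inter> (X - left_ends)) \<union> (A \<inter> left_ends)"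
      proof (cases "x \<in> left_ends")
        case True
        then have "flip N x = x" by (simp add: flip_def)
        then show ?thesis using True A by auto
      qed (use flip_not_left_end in auto)
    qed
    have "emeasure lebesgue (flip N -` A \<inter> X) = emeasure lebesgue (A - left_ends)"
      unfolding split using flip_preserves_measure_off_left_ends[OF A'] Z
      by (simp add: emeasure_Un_null_set)
    also have "\<dots> = emeasure lebesgue A"
      using emeasure_Diff_null_set[OF null_left_ends A(1)] by simp
    finally show ?thesis
      unfolding split using flip_preserves_measure_off_left_ends(1)[OF A'] Z by auto
  qed
  show ?thesis
    unfolding measure_preserving_map_def
  proof (intro conjI ballI measurableI)
    fix x assume "x \<in> space (lebesgue_on X)"
    then show "flip N x \<in> space (lebesgue_on X)" using flip_X by (simp add: space_restrict_space)
  next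
    fix A assume A: "A \<in> sets (lebesgue_on X)"
    then show "flip N -` A \<inter> space (lebesgue_on X) \<in> sets (lebesgue_on X)"
      using main[of A] by (simp add: space_restrict_space sets_restrict_space_iff)
    show "emeasure (lebesgue_on X) (flip N -` A \<inter> space (lebesgue_on X)) = emeasure (lebesgue_on X) A"
      using main[of A] A by (simp add: space_restrict_space sets_restrict_space_iff emeasure_restrict_space)
  qed
qed

lemma isomorphic_to_inverse:
  "isomorphic_transformations (lebesgue_on X) T (lebesgue_on X) (inv_into X T)"
proof -
  have generic: "AE x in lebesgue_on X. x \<in> X \<and> x \<notin> left_ends"
    using AE_not_in[OF null_left_ends] by (auto simp: AE_restrict_space_iff elim!: eventually_mono)
  show ?thesis
    unfolding isomorphic_transformations_def
  proof (intro exI conjI)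
    show "measure_preserving_map (lebesgue_on X) (lebesgue_on X) (flip N)"
      by (rule flip_preserves_measure)
    then show "flip N \<in> lebesgue_on X \<rightarrow>\<^sub>M lebesgue_on X"
      by (simp add: measure_preserving_map_def)
    show "AE x in lebesgue_on X. flip N (flip N x) = x" "AE x in lebesgue_on X. flip N (flip N x) = x"
      using generic by (rule eventually_mono; simp add: flip_flip)+
    show "AE x in lebesgue_on X. flip N (T x) = inv_into X T (flip N x)"
      using generic by (rule eventually_mono) (simp add: flip_reverses)
  qed
qed

end

end

section \<open>Columns separated by long spacers\<close>

locale spaced_system = rank_one_system +
  fixes M R :: nat
  assumes long_spacers: "\<And>n i. M \<le> n \<Longrightarrow> i < r n - 1 \<Longrightarrow> h n \<le> s n ! i"
    and few_cuts: "\<And>n. M \<le> n \<Longrightarrow> r n \<le> R"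
begin

lemma start_gap: "M \<le> n \<Longrightarrow> i < j \<Longrightarrow> j < r n \<Longrightarrow> start n i + 2 * h n \<le> start n j"
  using start_less[of i j n] long_spacers[of n i] by linarith

text \<open>
  Between two consecutive copies of \<open>C a\<close> lie the spacers inserted at some stage \<open>\<ge> a\<close>, at least
  as many as the height of the column at that stage.
\<close>

lemma copies_gap:
  assumes "M \<le> a" "a \<le> m" "u \<in> copies a m" "v \<in> copies a m" "u < v"
  shows "u + 2 * h a \<le> v"
  using assms(2-)
proof (induction m arbitrary: u v rule: dec_induct)
  case (step m)
  obtain i k where ik: "i < r m" "k \<in> copies a m" "u = start m i + k"
    using step by (auto simp: copies_Suc)
  obtain j l where jl: "j < r m" "l \<in> copies a m" "v = start m j + l"
    using step by (auto simp: copies_Suc)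
  have M: "M \<le> m" using assms step by simp
  have b: "k + h a \<le> h m" "l + h a \<le> h m" using copies_bound[OF step(1)] ik jl by auto
  have a: "h a \<le> h m" using h_mono[OF step(1)] .
  show ?case
  proof (cases i j rule: linorder_cases)
    case less
    then show ?thesis using start_gap[OF M less jl(1)] ik jl b a by linarith
  next
    case equal
    then show ?thesis using step.IH[of k l] ik jl step.prems by simp
  next
    case greater
    then show ?thesis using start_gap[OF M greater ik(1)] ik jl b step.prems by linarith
  qed
qed simp

text \<open>
  Dividing by \<open>R * card (copies a b)\<close>: the pattern meets a proper translate of itself in a proportion
  of at most \<open>1 - 1 / R\<close>. A translation by less than \<open>h b\<close> cannot make different copies of \<open>C b\<close> in
  \<open>C (Suc b)\<close> meet, as they are too far apart, so the proportion is inherited from \<open>C b\<close>. A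
  longer translation carries the last of the \<open>r b \<le> R\<close> copies out of \<open>C (Suc b)\<close>.
\<close>

lemma few_self_overlaps:
  assumes "M \<le> a" "a \<le> b" "0 < d"
  shows "R * card {k \<in> copies a b. k + d \<in> copies a b} + card (copies a b) \<le> R * card (copies a b)"
  using assms(2)
proof (induction b rule: dec_induct)
  case base
  have "2 \<le> R" using few_cuts[of a] r_ge_2[of a] assms by linarith
  moreover have "{k \<in> copies a a. k + d \<in> copies a a} = {}" using assms(3) by auto
  ultimately show ?case by (simp only: card.empty) simp
next
  case (step b)
  let ?Q = "copies a b"
  have M: "M \<le> b" using assms step by simp
  have bound: "k < h b" if "k \<in> ?Q" for k using copies_less[OF step(1) that] .
  show ?case
  proof (cases "d < h b")
    case True
    have "{k \<in> copies a (Suc b). k + d \<in> copies a (Suc b)}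
        \<subseteq> (\<lambda>(i, k). start b i + k) ` ({..<r b} \<times> {k \<in> ?Q. k + d \<in> ?Q})"
    proof clarify
      fix t assume t: "t \<in> copies a (Suc b)" "t + d \<in> copies a (Suc b)"
      obtain i k where ik: "i < r b" "k \<in> ?Q" "t = start b i + k"
        using t step(1) by (auto simp: copies_Suc)
      obtain j l where jl: "j < r b" "l \<in> ?Q" "t + d = start b j + l"
        using t step(1) by (auto simp: copies_Suc)
      have "i = j"
      proof (cases i j rule: linorder_cases)
        case less
        then show ?thesis using start_gap[OF M less jl(1)] ik jl bound[of k] True by linarith
      next
        case greater
        then show ?thesis using start_gap[OF M greater ik(1)] ik jl bound[of l] by linarith
      qed
      then show "t \<in> (\<lambda>(i, k). start b i + k) ` ({..<r b} \<times> {k \<in> ?Q. k + d \<in> ?Q})"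
        using ik jl by force
    qed
    then have "card {k \<in> copies a (Suc b). k + d \<in> copies a (Suc b)}
        \<le> card ((\<lambda>(i, k). start b i + k) ` ({..<r b} \<times> {k \<in> ?Q. k + d \<in> ?Q}))"
      by (intro card_mono) (auto simp: finite_copies)
    also have "\<dots> \<le> card ({..<r b} \<times> {k \<in> ?Q. k + d \<in> ?Q})"
      by (intro card_image_le) (auto simp: finite_copies)
    also have "\<dots> = r b * card {k \<in> ?Q. k + d \<in> ?Q}"
      by (simp add: card_cartesian_product)
    finally have "R * card {k \<in> copies a (Suc b). k + d \<in> copies a (Suc b)} + r b * card ?Q
        \<le> r b * (R * card {k \<in> ?Q. k + d \<in> ?Q} + card ?Q)"
      by (simp add: algebra_simps)
    also have "\<dots> \<le> r b * (R * card ?Q)" using step.IH by (intro mult_left_mono) auto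
    finally show ?thesis by (simp add: card_copies_Suc[OF step(1)] algebra_simps)
  next
    case False
    have "{k \<in> copies a (Suc b). k + d \<in> copies a (Suc b)}
        \<subseteq> (\<lambda>(i, k). start b i + k) ` ({..<r b - 1} \<times> ?Q)"
    proof clarify
      fix t assume t: "t \<in> copies a (Suc b)" "t + d \<in> copies a (Suc b)"
      obtain i k where ik: "i < r b" "k \<in> ?Q" "t = start b i + k"
        using t step(1) by (auto simp: copies_Suc)
      have "i \<noteq> r b - 1"
      proof
        assume "i = r b - 1"
        then have "t + d \<ge> h (Suc b)" using False ik by (simp add: h_Suc)
        then show False using copies_less[of a "Suc b" "t + d"] step(1) t by simp
      qed
      then show "t \<in> (\<lambda>(i, k). start b i + k) ` ({..<r b - 1} \<times> ?Q)" using ik by force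
    qed
    then have "card {k \<in> copies a (Suc b). k + d \<in> copies a (Suc b)}
        \<le> card ((\<lambda>(i, k). start b i + k) ` ({..<r b - 1} \<times> ?Q))"
      by (intro card_mono) (auto simp: finite_copies)
    also have "\<dots> \<le> card ({..<r b - 1} \<times> ?Q)"
      by (intro card_image_le) (auto simp: finite_copies)
    also have "\<dots> = (r b - 1) * card ?Q" by (simp add: card_cartesian_product)
    finally have "R * card {k \<in> copies a (Suc b). k + d \<in> copies a (Suc b)} + r b * card ?Q
        \<le> R * ((r b - 1) * card ?Q) + R * card ?Q"
      using few_cuts[OF M] by (intro add_mono mult_left_mono mult_right_mono) auto
    also have "\<dots> = R * (r b * card ?Q)"
      using r_pos[of b] by (cases "r b") (auto simp: algebra_simps)
    finally show ?thesis by (simp add: card_copies_Suc[OF step(1)])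
  qed
qed

text \<open>
  The combinatorial core. The position \<open>l\<close> in \<open>C m\<close> is that of the image of a point which traverses
  \<open>C (Suc n)\<close> upwards while its image moves downwards from \<open>l\<close>. The set of times at which the image
  meets the base of \<open>C M\<close> during the \<open>i\<close>-th passage through \<open>C n\<close> is \<open>P i\<close> below. The number of
  times that it shares with \<open>P 0\<close> is too large for two different translates of the pattern, by
  \<open>few_self_overlaps\<close>, so all passages see the same translate.
\<close>

lemma palindromic_of_reversed_pattern:
  assumes "M \<le> n" "n < m" "l < h m" "h (Suc n) \<le> l"
    and overlap: "\<And>i. i < r n \<Longrightarrow>
      R * card (copies M n) < R * card ({k. k < h n \<and> l - (start n i + k) \<in> copies M m} \<inter>
        {k. k < h n \<and> l - k \<in> copies M m}) + card (copies M n)"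
  shows "s n = rev (s n)"
proof -
  let ?Q = "copies M n"
  define P where "P i = {k. k < h n \<and> l - (start n i + k) \<in> copies M m}" for i
  have big: "R * card ?Q < R * card (P i \<inter> P 0) + card ?Q" if "i < r n" for i
    using overlap[OF that] by (simp add: P_def)
  have pl: "start n i + h n \<le> l" if "i < r n" for i
    using start_add_le[OF that] assms(4) by linarith
  \<comment> \<open>The image meets a single copy of \<open>C n\<close>, beginning at height \<open>u i\<close>, during the \<open>i\<close>-th passage.\<close>
  have "\<exists>u. \<forall>i<r n. u i \<in> copies n m \<and>
      (\<forall>k\<in>P i. \<exists>q\<in>?Q. l - (start n i + k) = u i + q)"
  proof -
    have "\<exists>u. u \<in> copies n m \<and> (\<forall>k\<in>P i. \<exists>q\<in>?Q. l - (start n i + k) = u + q)" if i: "i < r n" for i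
    proof -
      have dec: "\<exists>u\<in>copies n m. \<exists>q\<in>?Q. l - (start n i + k) = u + q" if "k \<in> P i" for k
        using that copies_trans[of M n m] assms by (simp add: P_def)
      have "P i \<noteq> {}"
      proof
        assume "P i = {}"
        then show False using big[OF i] few_cuts[OF assms(1)] r_pos[of n] by (cases R) auto
      qed
      then obtain k0 where k0: "k0 \<in> P i" by auto
      obtain u0 q0 where u0: "u0 \<in> copies n m" "q0 \<in> ?Q" "l - (start n i + k0) = u0 + q0"
        using dec[OF k0] by auto
      have "\<exists>q\<in>?Q. l - (start n i + k) = u0 + q" if k: "k \<in> P i" for k
      proof -
        obtain u q where u: "u \<in> copies n m" "q \<in> ?Q" "l - (start n i + k) = u + q"
          using dec[OF k] by auto
        have "q < h n" "q0 < h n" using u u0 copies_less assms by auto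
        moreover have "k < h n" "k0 < h n" using k k0 by (auto simp: P_def)
        ultimately have "\<not> u0 + 2 * h n \<le> u" "\<not> u + 2 * h n \<le> u0"
          using u u0 pl[OF i] by linarith+
        then have "u = u0"
          using copies_gap[of n m u u0] copies_gap[of n m u0 u] assms u u0
          by (metis linorder_neqE_nat order_less_imp_le)
        then show ?thesis using u by auto
      qed
      then show ?thesis using u0 by blast
    qed
    then show ?thesis by metis
  qed
  then obtain u where u: "\<And>i. i < r n \<Longrightarrow> u i \<in> copies n m"
    and uP: "\<And>i k. i < r n \<Longrightarrow> k \<in> P i \<Longrightarrow> \<exists>q\<in>?Q. l - (start n i + k) = u i + q" by metis
  \<comment> \<open>Otherwise \<open>P i\<close> and \<open>P 0\<close> would come from two different translates of the reversed pattern.\<close>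
  have aligned: "start n i + u i = u 0" if i: "i < r n" for i
  proof (rule ccontr)
    assume ne: "start n i + u i \<noteq> u 0"
    have q: "\<exists>q\<in>?Q. l = start n i + k + u i + q" "\<exists>q\<in>?Q. l = k + u 0 + q" if "k \<in> P i \<inter> P 0" for k
      using uP[OF i, of k] uP[of 0 k] that r_pos[of n] pl[OF i] by (auto simp: P_def; force)+
    define lo hi where "lo = min (start n i + u i) (u 0)" and "hi = max (start n i + u i) (u 0)"
    define d where "d = hi - lo"
    have d: "0 < d" "lo + d = hi" using ne by (auto simp: d_def lo_def hi_def)
    let ?O = "{q \<in> ?Q. q + d \<in> ?Q}"
    have sub: "(\<lambda>k. l - k - hi) ` (P i \<inter> P 0) \<subseteq> ?O"
    proof clarify
      fix k assume "k \<in> P i" "k \<in> P 0"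
      then obtain q q' where "q \<in> ?Q" "q' \<in> ?Q" "l = start n i + k + u i + q" "l = k + u 0 + q'"
        using q[of k] by blast
      then obtain q1 q2 where *: "q1 \<in> ?Q" "q2 \<in> ?Q" "l = k + hi + q1" "l = k + lo + q2"
        unfolding lo_def hi_def
        by (cases "start n i + u i \<le> u 0") (auto simp: ac_simps)
      have "l - k - hi = q1" "l - k - hi + d = q2" using *(3,4) d by linarith+
      then show "l - k - hi \<in> ?Q \<and> l - k - hi + d \<in> ?Q" using * by metis
    qed
    have "inj_on (\<lambda>k. l - k - hi) (P i \<inter> P 0)"
    proof (rule inj_onI)
      fix k k' assume k: "k \<in> P i \<inter> P 0" "k' \<in> P i \<inter> P 0" "l - k - hi = l - k' - hi"
      have "k + hi \<le> l" "k' + hi \<le> l"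
        using q[OF k(1)] q[OF k(2)] by (auto simp: hi_def)
      then show "k = k'" using k(3) by linarith
    qed
    then have "card (P i \<inter> P 0) \<le> card ?O"
      using sub by (rule card_inj_on_le) (simp add: finite_copies)
    then have "R * card (P i \<inter> P 0) \<le> R * card ?O" by (rule mult_left_mono) simp
    then show False
      using big[OF i] few_self_overlaps[OF order_refl assms(1) d(1)] by linarith
  qed
  \<comment> \<open>\<open>u i\<close> is the beginning of subcolumn \<open>j i\<close> in the copy of \<open>C (Suc n)\<close> that begins at \<open>g i\<close>.\<close>
  have "\<exists>g j. \<forall>i<r n. g i \<in> copies (Suc n) m \<and> j i < r n \<and> u i = g i + start n (j i)"
  proof -
    have "\<exists>g j. g \<in> copies (Suc n) m \<and> j < r n \<and> u i = g + start n j" if "i < r n" for i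
      using u[OF that] copies_trans[of n "Suc n" m "u i"] assms by (auto simp: copies_Suc)
    then show ?thesis by metis
  qed
  then obtain g j where g: "\<And>i. i < r n \<Longrightarrow> g i \<in> copies (Suc n) m"
    and j: "\<And>i. i < r n \<Longrightarrow> j i < r n" and ugj: "\<And>i. i < r n \<Longrightarrow> u i = g i + start n (j i)" by metis
  have g_eq: "g i = g 0" if i: "i < r n" for i
  proof -
    have "start n (j i) + h n \<le> h (Suc n)" "start n (j 0) + h n \<le> h (Suc n)" "start n i + h n \<le> h (Suc n)"
      using start_add_le j i r_pos[of n] by auto
    then have "\<not> g i + 2 * h (Suc n) \<le> g 0" "\<not> g 0 + 2 * h (Suc n) \<le> g i"
      using aligned[OF i] ugj[OF i] ugj[OF r_pos] h_pos[of n] by linarith+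
    then show ?thesis
      using copies_gap[of "Suc n" m "g i" "g 0"] copies_gap[of "Suc n" m "g 0" "g i"] g[OF i] g[OF r_pos] assms
      by (metis Suc_leI le_SucI linorder_neqE_nat)
  qed
  have sum_const: "start n i + start n (j i) = start n (j 0)" if "i < r n" for i
    using aligned[OF that] ugj[OF that] ugj[OF r_pos] g_eq[OF that] by simp
  have j_dec: "j i' < j i" if "i < i'" "i' < r n" for i i'
  proof (rule ccontr)
    assume "\<not> j i' < j i"
    then have "start n (j i) \<le> start n (j i')"
      using start_strict_mono[OF h_pos] by (metis le_eq_less_or_eq not_le_imp_less)
    then show False
      using sum_const[of i] sum_const[of i'] that start_strict_mono[OF h_pos that(1), of n] by simp
  qed
  \<comment> \<open>A strictly decreasing map of \<open>{..<r n}\<close> into itself is the reversal.\<close>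
  have j_low: "r n - 1 - i \<le> j i" if "i < r n" for i
    using that
  proof (induction "r n - 1 - i" arbitrary: i)
    case (Suc x)
    then have "r n - 1 - Suc i \<le> j (Suc i)" by (intro Suc.hyps(1)) auto
    then show ?case using j_dec[of i "Suc i"] Suc by linarith
  qed simp
  have j_high: "j i \<le> r n - 1 - i" if "i < r n" for i
    using that
  proof (induction i)
    case 0
    then show ?case using j[of 0] by simp
  next
    case (Suc i)
    then show ?case using j_dec[of i "Suc i"] by simp
  qed
  have refl: "start n i + start n (r n - 1 - i) = start n (r n - 1)" if "i < r n" for i
    using sum_const[OF that] j_low[OF that] j_high[OF that] j_low[OF r_pos] j_high[OF r_pos]
    by (metis diff_zero le_antisym)
  show "s n = rev (s n)"
  proof (rule nth_equalityI)
    fix i assume "i < length (s n)"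
    then have i: "Suc i < r n" by (simp add: length_s)
    then have e: "r n - 1 - i = Suc (r n - 1 - Suc i)" by simp
    have "start n (Suc i) + start n (r n - 1 - Suc i) = start n i + start n (Suc (r n - 1 - Suc i))"
      using refl[of i] refl[of "Suc i"] i e by simp
    then have "s n ! i = s n ! (r n - 1 - Suc i)" by (simp add: start_Suc)
    then show "s n ! i = rev (s n) ! i" using i by (simp add: rev_nth length_s)
  qed simp
qed

text \<open>
  The analytic part: a point \<open>x\<close> with the visits required by \<open>palindromic_of_reversed_pattern\<close>. Each
  passage of \<open>x\<close> through a copy of \<open>C n\<close> misses few of the indices \<open>I\<close> of the levels that approximate
  \<open>E\<close>, and the number of these indices is nearly that of the whole pattern. So the visiting times
  of any two passages share most of \<open>I\<close>.
\<close>

lemma eventually_palindromic: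
  assumes mp: "measure_preserving_map (lebesgue_on X) (lebesgue_on X) \<phi>"
    and equivariant: "AE x in lebesgue_on X. \<phi> (T x) = inv_into X T (\<phi> x)"
  shows "\<exists>N. \<forall>n\<ge>N. s n = rev (s n)"
proof -
  define E where "E = \<phi> -` L M 0 \<inter> X"
  have R: "2 \<le> R" using few_cuts[of M] r_ge_2[of M] by simp
  have meas: "\<phi> \<in> lebesgue_on X \<rightarrow>\<^sub>M lebesgue_on X"
    and pres: "\<And>A. A \<in> sets lebesgue \<Longrightarrow> A \<subseteq> X \<Longrightarrow>
      \<phi> -` A \<inter> X \<in> sets lebesgue \<and> emeasure lebesgue (\<phi> -` A \<inter> X) = emeasure lebesgue A"
  proof -
    show meas: "\<phi> \<in> lebesgue_on X \<rightarrow>\<^sub>M lebesgue_on X"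
      using mp by (simp add: measure_preserving_map_def)
    fix A assume A: "A \<in> sets lebesgue" "A \<subseteq> X"
    then have A': "A \<in> sets (lebesgue_on X)" by (simp add: sets_restrict_space_iff)
    have "emeasure (lebesgue_on X) (\<phi> -` A \<inter> X) = emeasure (lebesgue_on X) A"
      using mp A' unfolding measure_preserving_map_def by (simp add: space_restrict_space)
    moreover have "\<phi> -` A \<inter> X \<in> sets lebesgue"
      using measurable_sets[OF meas A'] by (simp add: space_restrict_space sets_restrict_space_iff)
    ultimately show "\<phi> -` A \<inter> X \<in> sets lebesgue \<and> emeasure lebesgue (\<phi> -` A \<inter> X) = emeasure lebesgue A"
      using A by (simp add: emeasure_restrict_space)
  qed
  have \<phi>_X: "\<phi> x \<in> X" if "x \<in> X" for x
    using measurable_space[OF meas, of x] that by (simp add: space_restrict_space)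
  have E: "E \<in> sets lebesgue" "E \<subseteq> X" "emeasure lebesgue E = ennreal (w M)"
    using pres[of "L M 0"] L_subset_X[OF h_pos] by (auto simp: E_def emeasure_L)
  have generic: "AE x in lebesgue. x \<in> X \<longrightarrow> \<phi> (T x) = inv_into X T (\<phi> x) \<and> \<phi> x \<notin> left_ends"
  proof -
    have "left_ends \<inter> X \<in> null_sets lebesgue"
      using null_left_ends by (intro null_set_Int2) auto
    then have "\<phi> -` (left_ends \<inter> X) \<inter> X \<in> null_sets lebesgue"
      using pres[of "left_ends \<inter> X"] by (auto simp: null_sets_def)
    then have "AE x in lebesgue. x \<notin> \<phi> -` (left_ends \<inter> X) \<inter> X" by (rule AE_not_in)
    moreover have "AE x in lebesgue. x \<in> X \<longrightarrow> \<phi> (T x) = inv_into X T (\<phi> x)"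
      using equivariant by (simp add: AE_restrict_space_iff)
    ultimately show ?thesis by eventually_elim (use \<phi>_X in auto)
  qed
  \<comment> \<open>Fewer than \<open>K = e / w (Suc n)\<close> visits of \<open>x\<close> are wrong. The factor \<open>3\<close> pays for the passages \<open>i\<close>
    and \<open>0\<close> and for the deficit of \<open>card I\<close>, one factor \<open>R\<close> for the ratio \<open>w n / w (Suc n)\<close>, and the other
    for the proportion \<open>1 / R\<close> that may be lost.\<close>
  define e where "e = w M / (3 * real R ^ 2)"
  have e: "0 < e" using w_pos[of M] R by (simp add: e_def)
  obtain N where N: "\<And>n. n \<ge> N \<Longrightarrow> \<exists>I\<subseteq>{..<h n}.
      emeasure lebesgue ((\<Union>k\<in>I. L n k) - E) < ennreal e
      \<and> emeasure lebesgue (E - (\<Union>k\<in>I. L n k)) < ennreal e"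
    using approximation_by_levels[OF E(1,2) _ e] E(3) by auto
  have "s n = rev (s n)" if n: "max M N \<le> n" for n
  proof -
    have Mn: "M \<le> n" using n by simp
    obtain I where I: "I \<subseteq> {..<h n}" "emeasure lebesgue ((\<Union>k\<in>I. L n k) - E) < ennreal e"
      "emeasure lebesgue (E - (\<Union>k\<in>I. L n k)) < ennreal e" using N[of n] n by auto
    define U where "U = (\<Union>k\<in>I. L n k)"
    have finI: "finite I" using I(1) finite_subset by blast
    have sets_U: "U \<in> sets lebesgue" unfolding U_def by (intro sets.finite_UN finI) auto
    define K where "K = e / w (Suc n)"
    have K: "K * w (Suc n) = e" using w_pos[of "Suc n"] by (simp add: K_def)
    have K_pos: "K > 0" using e w_pos by (simp add: K_def)
    define q where "q = card (copies M n)"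
    have q: "real q * w n = w M" using card_copies_width[OF Mn] by (simp add: q_def)
    have K_q: "3 * real R * K \<le> real q"
    proof -
      have "3 * real R * K * w n = 3 * real R * real (r n) * e" by (simp add: w_Suc[of n] flip: K)
      also have "\<dots> \<le> 3 * real R * real R * e"
        using few_cuts[OF Mn] e by (intro mult_right_mono mult_left_mono) auto
      also have "\<dots> = real q * w n" using R by (simp add: e_def q power2_eq_square)
      finally show ?thesis using w_pos[of n] by simp
    qed
    have card_I: "real q - K < real (card I)"
    proof -
      have "emeasure lebesgue U = (\<Sum>k\<in>I. emeasure lebesgue (L n k))"
        unfolding U_def using finI disjoint_L[OF I(1)] by (intro sum_emeasure[symmetric]) auto
      also have "\<dots> = ennreal (real (card I) * w n)"
        using w_pos[of n] by (simp add: emeasure_L ennreal_mult ennreal_of_nat_eq_real_of_nat)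
      finally have U: "emeasure lebesgue U = ennreal (real (card I) * w n)" .
      have "ennreal (w M) \<le> emeasure lebesgue (U \<union> (E - U))"
        unfolding E(3)[symmetric] using sets_U E by (intro emeasure_mono) auto
      also have "\<dots> \<le> emeasure lebesgue U + emeasure lebesgue (E - U)"
        using sets_U E by (intro emeasure_subadditive) auto
      also have "\<dots> < ennreal (real (card I) * w n) + ennreal e"
        unfolding U using I(3)[folded U_def] by (subst ennreal_add_left_cancel_less) auto
      also have "\<dots> = ennreal (real (card I) * w n + e)"
        using e w_pos[of n] by (simp add: ennreal_plus)
      finally have "w M < real (card I) * w n + e"
        using w_pos[of M] by (simp add: ennreal_less_iff less_imp_le)
      also have "e \<le> K * w n"
      proof -
        have "K * w (Suc n) \<le> K * w n"
          using r_pos[of n] K_pos w_pos[of "Suc n"] by (simp add: w_Suc[of n])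
        then show ?thesis by (simp add: K)
      qed
      finally have "real q * w n < (real (card I) + K) * w n" by (simp add: q algebra_simps)
      then show ?thesis using w_pos[of n] by simp
    qed
    have "AE x in lebesgue. \<forall>j\<in>{..<h (Suc n)}. x + C (Suc n) ! j \<in> X \<longrightarrow>
        \<phi> (T (x + C (Suc n) ! j)) = inv_into X T (\<phi> (x + C (Suc n) ! j))
        \<and> \<phi> (x + C (Suc n) ! j) \<notin> left_ends"
      by (intro AE_finite_allI AE_lebesgue_translate[OF generic]) simp
    moreover have "U - E \<in> sets lebesgue" "emeasure lebesgue (U - E) < ennreal (K * w (Suc n))"
      using sets_U E I(2) by (auto simp: K U_def)
    ultimately obtain x where x: "x \<in> L (Suc n) 0"
      and x_generic: "\<forall>j\<in>{..<h (Suc n)}. x + C (Suc n) ! j \<in> X \<longrightarrow>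
        \<phi> (T (x + C (Suc n) ! j)) = inv_into X T (\<phi> (x + C (Suc n) ! j))
        \<and> \<phi> (x + C (Suc n) ! j) \<notin> left_ends"
      and few: "real (card {j. j < h (Suc n) \<and> x + C (Suc n) ! j \<in> U - E}) < K"
      by (rule_tac few_visits)
    define orb where "orb j = x + C (Suc n) ! j" for j
    have orb_L: "orb j \<in> L (Suc n) j" if "j < h (Suc n)" for j
      using x by (auto simp: orb_def mem_L C_0)
    have orb_X: "orb j \<in> X" if "j < h (Suc n)" for j
      using orb_L[OF that] L_subset_X[OF that] by auto
    have orb_Suc: "\<phi> (orb (Suc j)) = inv_into X T (\<phi> (orb j))" if "Suc j < h (Suc n)" for j
    proof -
      have "orb (Suc j) = T (orb j)" using T_eq[OF orb_L that] that by (simp add: orb_def)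
      then show ?thesis using x_generic orb_X[of j] that by (simp add: orb_def)
    qed
    have "orb 0 = x" by (simp add: orb_def C_0)
    then have "\<phi> x \<in> X" "\<phi> x \<notin> left_ends"
      using orb_X[OF h_pos] \<phi>_X x_generic h_pos[of "Suc n"] by (auto simp: orb_def dest!: bspec[of _ _ 0])
    then obtain m l where ml: "Suc n \<le> m" "l < h m" "h (Suc n) \<le> l" "\<phi> x \<in> L m l"
      by (rule high_level)
    have image_orbit: "\<phi> (orb j) \<in> L m (l - j)" if "j < h (Suc n)" for j
      using that
    proof (induction j)
      case 0
      then show ?case using ml \<open>orb 0 = x\<close> by simp
    next
      case (Suc j)
      then have "l - j = Suc (l - Suc j)" using ml by linarith
      then show ?case
        using Suc inv_T_eq(2)[of "\<phi> (orb j)" m "l - Suc j"] orb_Suc[OF Suc.prems] ml by simp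
    qed
    have E_iff: "orb j \<in> E \<longleftrightarrow> l - j \<in> copies M m" if "j < h (Suc n)" for j
      using mem_base_iff[OF _ _ image_orbit[OF that], of M] orb_X[OF that] ml Mn by (simp add: E_def)
    define P where "P i = {k. k < h n \<and> l - (start n i + k) \<in> copies M m}" for i
    have miss: "real (card (I - P i)) < K" if i: "i < r n" for i
    proof -
      have "(\<lambda>k. start n i + k) ` (I - P i) \<subseteq> {j. j < h (Suc n) \<and> orb j \<in> U - E}"
      proof clarify
        fix k assume k: "k \<in> I" "k \<notin> P i"
        have kh: "k < h n" using k I by auto
        have j: "start n i + k < h (Suc n)" using start_add_less[OF i kh] .
        have "orb (start n i + k) \<in> L n k" using orb_L[OF j] L_Suc_subset[OF i kh] by blast
        then have "orb (start n i + k) \<in> U" using k by (auto simp: U_def)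
        moreover have "orb (start n i + k) \<notin> E" using k kh E_iff[OF j] by (simp add: P_def)
        ultimately show "start n i + k < h (Suc n) \<and> orb (start n i + k) \<in> U - E" using j by blast
      qed
      then have "card (I - P i) \<le> card {j. j < h (Suc n) \<and> orb j \<in> U - E}"
        by (intro card_inj_on_le[of "\<lambda>k. start n i + k"]) (auto simp: inj_on_def)
      then show ?thesis using few by (simp add: orb_def)
    qed
    have overlap: "R * q < R * card (P i \<inter> P 0) + q" if i: "i < r n" for i
    proof -
      have "I \<subseteq> (P i \<inter> P 0) \<union> ((I - P i) \<union> (I - P 0))" by auto
      then have "card I \<le> card ((P i \<inter> P 0) \<union> ((I - P i) \<union> (I - P 0)))"
        using finI by (intro card_mono) (auto simp: P_def)
      also have "\<dots> \<le> card (P i \<inter> P 0) + (card (I - P i) + card (I - P 0))"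
        by (meson add_left_mono card_Un_le le_trans)
      finally have "real (card I) \<le> real (card (P i \<inter> P 0)) + (real (card (I - P i)) + real (card (I - P 0)))"
        by linarith
      then have "real q < real (card (P i \<inter> P 0)) + 3 * K"
        using miss[OF i] miss[OF r_pos] card_I by linarith
      then have "real R * real q < real R * (real (card (P i \<inter> P 0)) + 3 * K)"
        using R by (intro mult_strict_left_mono) auto
      also have "\<dots> \<le> real R * real (card (P i \<inter> P 0)) + real q"
        using K_q by (simp add: algebra_simps)
      finally show ?thesis
        by (metis of_nat_add of_nat_less_iff of_nat_mult)
    qed
    show ?thesis
      by (rule palindromic_of_reversed_pattern[of n m l])
        (use overlap Mn ml in \<open>auto simp: P_def q_def\<close>)
  qed
  then show ?thesis by blast
qed

end

theorem theorem6p1: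
  fixes r :: "nat \<Rightarrow> nat" and s :: "nat \<Rightarrow> nat list" and C :: "nat \<Rightarrow> real list"
    and X :: "real set" and T :: "real \<Rightarrow> real"
  assumes "rank_one_parameters r s"
    and "rank_one_columns r s C"
    and "X = rank_one_space r C"
    and "T = rank_one_map r C"
    and "partially_bounded r s"
  shows "isomorphic_transformations (lebesgue_on X) T (lebesgue_on X) (inv_into X T)
         \<longleftrightarrow> (\<exists>N. \<forall>n\<ge>N. s n = rev (s n))"
proof -
  interpret rank_one_system r s C by unfold_locales (fact assms)+
  show ?thesis
    unfolding assms(3,4)
  proof
    obtain R S M where "\<And>n. M \<le> n \<Longrightarrow> r n < R"
      and "\<And>n i. M \<le> n \<Longrightarrow> i < r n - 1 \<Longrightarrow> length (rank_one_word s n) \<le> s n ! i"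
      using assms(5) unfolding partially_bounded_def by blast
    then interpret spaced_system r s C M R
      by unfold_locales (auto simp: length_rank_one_word intro: less_imp_le)
    assume "isomorphic_transformations (lebesgue_on (rank_one_space r C)) (rank_one_map r C)
      (lebesgue_on (rank_one_space r C)) (inv_into (rank_one_space r C) (rank_one_map r C))"
    then show "\<exists>N. \<forall>n\<ge>N. s n = rev (s n)"
      unfolding isomorphic_transformations_def using eventually_palindromic by blast
  next
    assume "\<exists>N. \<forall>n\<ge>N. s n = rev (s n)"
    then obtain N where "\<And>n. N \<le> n \<Longrightarrow> s n = rev (s n)" by blast
    then show "isomorphic_transformations (lebesgue_on (rank_one_space r C)) (rank_one_map r C)
      (lebesgue_on (rank_one_space r C)) (inv_into (rank_one_space r C) (rank_one_map r C))"
      by (rule isomorphic_to_inverse)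
  qed
qed

end
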